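(* Let $\mathsf M$ be a matroid on $[n]$ of rank $\ell$ and $\Bbbk$ a field. Then for all $0\le p\le \ell$, $$\mathcal R^p(\mathsf M)\subseteq \bigcup_{X\in L^{\mathrm{irr}}_{\le p+1}(\mathsf M)} P_{\{X,[n]\setminus X\}}.$$ That is, if $H^p(A(\mathsf M),\cdot v)\ne 0$, then there is an irreducible flat $X$ of rank at most $p+1$ such that $\sum_{i=1}^n v_i=0$ and $\sum_{i\in X}v_i=0$.
   Context: Let $V=\Bbbk^n$ with basis $e_1,\dots,e_n$, $E=\Lambda(V)$, $\partial$ the graded derivation with $\partial(e_i)=1$, $e_C=\prod_{i\in C}e_i$. $A(\mathsf M)=E/I$ with $I$ the ideal generated by $\partial(e_C)$ for circuits $C$. For $v\in V$, $(A(\mathsf M),\cdot v)$ is the cochain complex with differential $x\mapsto xv$; $\mathcal R^p(\mathsf M)=\{v\in V:H^p(A(\mathsf M),\cdot v)\ne0\}$. $L^{\mathrm{irr}}_{\le m}(\mathsf M)$ denotes the set of irreducible flats of rank at most $m$, i.e. nonempty flats $X$ of rank $\le m$ such that the restriction of $\mathsf M$ to $X$ is connected. For $X\subseteq[n]$, $P_{\{X,[n]\setminus X\}}=\{x\in\Bbbk^n:\sum_{i\in X}x_i=0,\ \sum_{i\notin X}x_i=0\}$. *)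

theory Defs
  imports "HOL-Algebra.QuotRing"
begin

section \<open>Matroids\<close>

locale matroid =
  fixes G :: "'a set" and \<I> :: "'a set set"
  assumes finite_ground: "finite G"
    and indep_subset: "A \<in> \<I> \<Longrightarrow> A \<subseteq> G"
    and indep_empty: "{} \<in> \<I>"
    and indep_mono: "A \<in> \<I> \<Longrightarrow> B \<subseteq> A \<Longrightarrow> B \<in> \<I>"
    and indep_augment: "A \<in> \<I> \<Longrightarrow> B \<in> \<I> \<Longrightarrow> card A < card B \<Longrightarrow> \<exists>x\<in>B - A. insert x A \<in> \<I>"

definition mrank :: "'a set set \<Rightarrow> 'a set \<Rightarrow> nat" where
  "mrank \<I> X = Max (card ` {A \<in> \<I>. A \<subseteq> X})"

definition circuits :: "'a set \<Rightarrow> 'a set set \<Rightarrow> 'a set set" where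
  "circuits G \<I> = {C. C \<subseteq> G \<and> C \<notin> \<I> \<and> (\<forall>D. D \<subset> C \<longrightarrow> D \<in> \<I>)}"

definition flats :: "'a set \<Rightarrow> 'a set set \<Rightarrow> 'a set set" where
  "flats G \<I> = {X. X \<subseteq> G \<and> (\<forall>x\<in>G - X. mrank \<I> X < mrank \<I> (insert x X))}"

text \<open>The independent sets of the restriction to \<open>X\<close>, a matroid on the ground set \<open>X\<close>.\<close>

definition mrestrict :: "'a set set \<Rightarrow> 'a set \<Rightarrow> 'a set set" where
  "mrestrict \<I> X = {A \<in> \<I>. A \<subseteq> X}"

definition mconnected :: "'a set \<Rightarrow> 'a set set \<Rightarrow> bool" where
  "mconnected G \<I> \<longleftrightarrow> (\<forall>x\<in>G. \<forall>y\<in>G. x \<noteq> y \<longrightarrow> (\<exists>C\<in>circuits G \<I>. x \<in> C \<and> y \<in> C))"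

definition irr_flats_le :: "'a set \<Rightarrow> 'a set set \<Rightarrow> nat \<Rightarrow> 'a set set" where
  "irr_flats_le G \<I> m =
     {X \<in> flats G \<I>. X \<noteq> {} \<and> mrank \<I> X \<le> m \<and> mconnected X (mrestrict \<I> X)}"


section \<open>The exterior algebra\<close>

text \<open>
  For a finite linearly ordered set \<open>G\<close>, the exterior algebra on the vector space with basis
  \<open>(e\<^sub>i)\<close> indexed by \<open>G\<close> has the basis \<open>e\<^sub>S\<close>, the increasing product of the \<open>e\<^sub>i\<close> with \<open>i \<in> S\<close>,
  for \<open>S \<subseteq> G\<close>. An element is represented by its family of coefficients, extended by zero to
  sets that are not subsets of \<open>G\<close>. For disjoint \<open>S\<close> and \<open>T\<close>,
  \<open>e\<^sub>S e\<^sub>T = ext_sign S T e\<^sub>S\<^sub>\<union>\<^sub>T\<close>.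
\<close>

definition ext_sign :: "'a::linorder set \<Rightarrow> 'a set \<Rightarrow> 'k::field" where
  "ext_sign S T = (- 1) ^ card {(s, t). s \<in> S \<and> t \<in> T \<and> t < s}"

definition ext_basis :: "'a set \<Rightarrow> 'a set \<Rightarrow> 'k::field" where
  "ext_basis S = (\<lambda>T. if T = S then 1 else 0)"

definition ext_mult ::
  "('a::linorder set \<Rightarrow> 'k::field) \<Rightarrow> ('a set \<Rightarrow> 'k) \<Rightarrow> 'a set \<Rightarrow> 'k" where
  "ext_mult f g = (\<lambda>S. \<Sum>T\<in>Pow S. ext_sign T (S - T) * f T * g (S - T))"

definition ext_alg :: "'a::linorder set \<Rightarrow> ('a set \<Rightarrow> 'k::field) ring" where
  "ext_alg G =
     \<lparr>carrier = {f. \<forall>S. f S \<noteq> 0 \<longrightarrow> S \<subseteq> G}, mult = ext_mult, one = ext_basis {},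
      zero = (\<lambda>_. 0), add = (\<lambda>f g S. f S + g S)\<rparr>"

definition ext_deg :: "'a::linorder set \<Rightarrow> nat \<Rightarrow> ('a set \<Rightarrow> 'k::field) set" where
  "ext_deg G p = {f. \<forall>S. f S \<noteq> 0 \<longrightarrow> S \<subseteq> G \<and> card S = p}"

text \<open>
  The graded derivation with \<open>\<partial> e\<^sub>i = 1\<close>. On basis elements it is
  \<open>\<partial> e\<^sub>C = (\<Sum>i\<in>C. ext_sign {i} (C - {i}) e\<^bsub>C - {i}\<^esub>)\<close>; below are the coefficients of the
  image of an arbitrary element. That this is a graded derivation is proved in
  \<open>ext_der_leibniz\<close>.
\<close>

definition ext_der ::
  "'a::linorder set \<Rightarrow> ('a set \<Rightarrow> 'k::field) \<Rightarrow> 'a set \<Rightarrow> 'k" where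
  "ext_der G f = (\<lambda>S. \<Sum>i\<in>G - S. ext_sign {i} S * f (insert i S))"

definition ext_vec :: "'a::linorder set \<Rightarrow> ('a \<Rightarrow> 'k::field) \<Rightarrow> 'a set \<Rightarrow> 'k" where
  "ext_vec G v = (\<lambda>S. \<Sum>i\<in>G. v i * ext_basis {i} S)"


section \<open>The Orlik--Solomon algebra and its resonance varieties\<close>

definition os_ideal :: "'a::linorder set \<Rightarrow> 'a set set \<Rightarrow> ('a set \<Rightarrow> 'k::field) set" where
  "os_ideal G \<I> = genideal (ext_alg G) ((\<lambda>C. ext_der G (ext_basis C)) ` circuits G \<I>)"

definition os_alg :: "'a::linorder set \<Rightarrow> 'a set set \<Rightarrow> ('a set \<Rightarrow> 'k::field) set ring" where
  "os_alg G \<I> = ext_alg G Quot os_ideal G \<I>"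

definition os_class ::
  "'a::linorder set \<Rightarrow> 'a set set \<Rightarrow> ('a set \<Rightarrow> 'k::field) \<Rightarrow> ('a set \<Rightarrow> 'k) set" where
  "os_class G \<I> f = os_ideal G \<I> +>\<^bsub>ext_alg G\<^esub> f"

definition os_deg ::
  "'a::linorder set \<Rightarrow> 'a set set \<Rightarrow> nat \<Rightarrow> ('a set \<Rightarrow> 'k::field) set set" where
  "os_deg G \<I> p = os_class G \<I> ` ext_deg G p"

definition os_diff ::
  "'a::linorder set \<Rightarrow> 'a set set \<Rightarrow> ('a \<Rightarrow> 'k::field) \<Rightarrow> ('a set \<Rightarrow> 'k) set \<Rightarrow> ('a set \<Rightarrow> 'k) set"
  where "os_diff G \<I> v x = x \<otimes>\<^bsub>os_alg G \<I>\<^esub> os_class G \<I> (ext_vec G v)"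

definition os_cocycles ::
  "'a::linorder set \<Rightarrow> 'a set set \<Rightarrow> ('a \<Rightarrow> 'k::field) \<Rightarrow> nat \<Rightarrow> ('a set \<Rightarrow> 'k) set set" where
  "os_cocycles G \<I> v p = {x \<in> os_deg G \<I> p. os_diff G \<I> v x = \<zero>\<^bsub>os_alg G \<I>\<^esub>}"

definition os_coboundaries ::
  "'a::linorder set \<Rightarrow> 'a set set \<Rightarrow> ('a \<Rightarrow> 'k::field) \<Rightarrow> nat \<Rightarrow> ('a set \<Rightarrow> 'k) set set" where
  "os_coboundaries G \<I> v p =
     (case p of 0 \<Rightarrow> {\<zero>\<^bsub>os_alg G \<I>\<^esub>} | Suc q \<Rightarrow> os_diff G \<I> v ` os_deg G \<I> q)"

text \<open>The cohomology is an additive group, written as a \<^typ>\<open>'a monoid\<close> in order to use \<open>Mod\<close>.\<close>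

definition os_cohomology ::
  "'a::linorder set \<Rightarrow> 'a set set \<Rightarrow> ('a \<Rightarrow> 'k::field) \<Rightarrow> nat \<Rightarrow> ('a set \<Rightarrow> 'k) set set monoid" where
  "os_cohomology G \<I> v p =
     (add_monoid (os_alg G \<I>)) \<lparr>carrier := os_cocycles G \<I> v p\<rparr> Mod os_coboundaries G \<I> v p"

text \<open>The vector space with basis \<open>(e\<^sub>i)\<close>, \<open>i \<in> G\<close>, is \<^term>\<open>G \<rightarrow>\<^sub>E (UNIV :: 'k set)\<close>.\<close>

definition resonance ::
  "'a::linorder set \<Rightarrow> 'a set set \<Rightarrow> nat \<Rightarrow> ('a \<Rightarrow> 'k::field) set" where
  "resonance G \<I> p =
     {v \<in> G \<rightarrow>\<^sub>E UNIV. carrier (os_cohomology G \<I> v p) \<noteq> {\<one>\<^bsub>os_cohomology G \<I> v p\<^esub>}}"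

definition P_space :: "'a set \<Rightarrow> 'a set \<Rightarrow> ('a \<Rightarrow> 'k::field) set" where
  "P_space G X = {x \<in> G \<rightarrow>\<^sub>E UNIV. (\<Sum>i\<in>X. x i) = 0 \<and> (\<Sum>i\<in>G - X. x i) = 0}"


section \<open>The defining properties of the exterior algebra\<close>

lemma ext_sign_Un_left:
  assumes "finite A" "finite B" "finite C" "A \<inter> B = {}"
  shows "ext_sign (A \<union> B) C = ext_sign A C * (ext_sign B C :: 'k::field)"
proof -
  have eq: "{(s, t). s \<in> A \<union> B \<and> t \<in> C \<and> t < s} =
      {(s, t). s \<in> A \<and> t \<in> C \<and> t < s} \<union> {(s, t). s \<in> B \<and> t \<in> C \<and> t < s}"
    by auto
  have "finite {(s, t). s \<in> A \<and> t \<in> C \<and> t < s}" "finite {(s, t). s \<in> B \<and> t \<in> C \<and> t < s}"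
    by (rule finite_subset[of _ "A \<times> C"], use assms in auto)
       (rule finite_subset[of _ "B \<times> C"], use assms in auto)
  then show ?thesis
    unfolding ext_sign_def eq using assms
    by (subst card_Un_disjoint) (auto simp: power_add)
qed

lemma ext_sign_Un_right:
  assumes "finite A" "finite B" "finite C" "B \<inter> C = {}"
  shows "ext_sign A (B \<union> C) = ext_sign A B * (ext_sign A C :: 'k::field)"
proof -
  have eq: "{(s, t). s \<in> A \<and> t \<in> B \<union> C \<and> t < s} =
      {(s, t). s \<in> A \<and> t \<in> B \<and> t < s} \<union> {(s, t). s \<in> A \<and> t \<in> C \<and> t < s}"
    by auto
  have "finite {(s, t). s \<in> A \<and> t \<in> B \<and> t < s}" "finite {(s, t). s \<in> A \<and> t \<in> C \<and> t < s}"
    by (rule finite_subset[of _ "A \<times> B"], use assms in auto)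
       (rule finite_subset[of _ "A \<times> C"], use assms in auto)
  then show ?thesis
    unfolding ext_sign_def eq using assms
    by (subst card_Un_disjoint) (auto simp: power_add)
qed

lemma ext_sign_empty [simp]: "ext_sign {} T = 1" "ext_sign S {} = 1"
  by (simp_all add: ext_sign_def)

lemma ext_sign_sq [simp]: "ext_sign S T * ext_sign S T = (1 :: 'k::field)"
  by (simp add: ext_sign_def flip: power_mult_distrib)

lemma ext_sign_swap:
  assumes "finite T" "i \<notin> T"
  shows "ext_sign T {i} = (- 1) ^ card T * (ext_sign {i} T :: 'k::field)"
proof -
  have 1: "{(s, t). s \<in> T \<and> t \<in> {i} \<and> t < s} = (\<lambda>s. (s, i)) ` {s \<in> T. i < s}"
    and 2: "{(s, t). s \<in> {i} \<and> t \<in> T \<and> t < s} = (\<lambda>s. (i, s)) ` {s \<in> T. s < i}"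
    by auto
  have "T = {s \<in> T. i < s} \<union> {s \<in> T. s < i}"
    using assms(2) by (auto, metis linorder_cases)
  then have "card T = card ({s \<in> T. i < s} \<union> {s \<in> T. s < i})"
    by simp
  also have "\<dots> = card {s \<in> T. i < s} + card {s \<in> T. s < i}"
    using assms(1) by (intro card_Un_disjoint) auto
  finally have 3: "card T = card {s \<in> T. i < s} + card {s \<in> T. s < i}" .
  have "ext_sign T {i} = ((- 1) ^ card {s \<in> T. i < s} :: 'k)"
    unfolding ext_sign_def 1 by (subst card_image) (auto simp: inj_on_def)
  moreover have "ext_sign {i} T = ((- 1) ^ card {s \<in> T. s < i} :: 'k)"
    unfolding ext_sign_def 2 by (subst card_image) (auto simp: inj_on_def)
  ultimately show ?thesis
    by (simp add: 3 power_add flip: power_mult_distrib)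
qed

lemma ext_mult_assoc:
  "ext_mult (ext_mult f g) h = ext_mult f (ext_mult g (h :: 'a::linorder set \<Rightarrow> 'k::field))"
proof
  fix S :: "'a set"
  show "ext_mult (ext_mult f g) h S = ext_mult f (ext_mult g h) S"
  proof (cases "finite S")
    case False
    then show ?thesis by (simp add: ext_mult_def)
  next
    case True
    note fin = finite_subset[OF _ True]
    have "ext_mult (ext_mult f g) h S =
        (\<Sum>(T, U)\<in>Sigma (Pow S) Pow.
           ext_sign T (S - T) * (ext_sign U (T - U) * f U * g (T - U)) * h (S - T))"
      using True by (auto simp: ext_mult_def sum_distrib_left sum_distrib_right
          intro!: trans[OF _ sum.Sigma] fin)
    also have "\<dots> = (\<Sum>(U, W)\<in>Sigma (Pow S) (\<lambda>U. Pow (S - U)).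
           ext_sign U (S - U) * f U * (ext_sign W (S - U - W) * g W * h (S - U - W)))"
    proof (rule sum.reindex_bij_witness[where i = "\<lambda>(U, W). (U \<union> W, U)" and j = "\<lambda>(T, U). (U, T - U)"],
        goal_cases)
      case (5 x)
      then obtain T U where x: "x = (T, U)" and sub: "T \<subseteq> S" "U \<subseteq> T"
        by auto
      have e1: "S - U - (T - U) = S - T" using sub by auto
      have "ext_sign T (S - T) = ext_sign U (S - T) * (ext_sign (T - U) (S - T) :: 'k)"
        using ext_sign_Un_left[of U "T - U" "S - T"] sub
        by (simp add: Un_absorb1 Un_Diff_cancel fin[of U] fin[of T] True subset_trans)
      moreover have "ext_sign U (S - U) = ext_sign U (T - U) * (ext_sign U (S - T) :: 'k)"
      proof -
        have "S - U = (T - U) \<union> (S - T)" using sub by auto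
        then show ?thesis
          using ext_sign_Un_right[of U "T - U" "S - T"] sub
          by (auto simp: fin[of U] fin[of T] True subset_trans)
      qed
      ultimately show ?case by (simp add: x e1)
    qed auto
    also have "\<dots> = ext_mult f (ext_mult g h) S"
      using True by (auto simp: ext_mult_def sum_distrib_left sum_distrib_right
          intro!: trans[OF sum.Sigma[symmetric]])
    finally show ?thesis .
  qed
qed

lemma ext_mult_one_left:
  assumes "\<And>S. f S \<noteq> 0 \<Longrightarrow> finite S"
  shows "ext_mult (ext_basis {}) f = (f :: 'a::linorder set \<Rightarrow> 'k::field)"
proof
  fix S
  show "ext_mult (ext_basis {}) f S = f S"
  proof (cases "finite S")
    case True
    have "ext_mult (ext_basis {}) f S =
        (\<Sum>T\<in>Pow S. if T = {} then ext_sign {} S * f S else 0)"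
      unfolding ext_mult_def by (rule sum.cong) (auto simp: ext_basis_def)
    then show ?thesis using True by simp
  qed (use assms[of S] in \<open>auto simp: ext_mult_def\<close>)
qed

lemma ext_mult_one_right:
  assumes "\<And>S. f S \<noteq> 0 \<Longrightarrow> finite S"
  shows "ext_mult f (ext_basis {}) = (f :: 'a::linorder set \<Rightarrow> 'k::field)"
proof
  fix S
  show "ext_mult f (ext_basis {}) S = f S"
  proof (cases "finite S")
    case True
    have "ext_mult f (ext_basis {}) S =
        (\<Sum>T\<in>Pow S. if T = S then ext_sign S {} * f S else 0)"
      unfolding ext_mult_def by (rule sum.cong) (auto simp: ext_basis_def)
    then show ?thesis using True by simp
  qed (use assms[of S] in \<open>auto simp: ext_mult_def\<close>)
qed

lemma ext_mult_support:
  fixes f g :: "'a::linorder set \<Rightarrow> 'k::field"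
  assumes "\<And>S. f S \<noteq> 0 \<Longrightarrow> S \<subseteq> G" "\<And>S. g S \<noteq> 0 \<Longrightarrow> S \<subseteq> G" "ext_mult f g S \<noteq> 0"
  shows "S \<subseteq> G"
proof -
  from assms(3) obtain T where "T \<subseteq> S" "ext_sign T (S - T) * f T * g (S - T) \<noteq> 0"
    unfolding ext_mult_def by (auto elim!: sum.not_neutral_contains_not_neutral)
  then show ?thesis using assms(1)[of T] assms(2)[of "S - T"] by auto
qed

lemma ring_ext_alg:
  assumes "finite G"
  shows "ring (ext_alg G :: ('a::linorder set \<Rightarrow> 'k::field) ring)"
proof (rule ringI)
  show "abelian_group (ext_alg G :: ('a set \<Rightarrow> 'k) ring)"
  proof (rule abelian_groupI)
    fix x :: "'a set \<Rightarrow> 'k" assume "x \<in> carrier (ext_alg G)"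
    then show "\<exists>y\<in>carrier (ext_alg G). y \<oplus>\<^bsub>ext_alg G\<^esub> x = \<zero>\<^bsub>ext_alg G\<^esub>"
      by (intro bexI[of _ "\<lambda>S. - x S"]) (auto simp: ext_alg_def)
  next
    fix x y :: "'a set \<Rightarrow> 'k"
    assume "x \<in> carrier (ext_alg G)" "y \<in> carrier (ext_alg G)"
    then show "x \<oplus>\<^bsub>ext_alg G\<^esub> y \<in> carrier (ext_alg G)"
      unfolding ext_alg_def by simp (metis add_0)
  qed (auto simp: ext_alg_def add.assoc add.commute)
  show "monoid (ext_alg G :: ('a set \<Rightarrow> 'k) ring)"
  proof (rule monoidI)
    fix x y :: "'a set \<Rightarrow> 'k"
    assume "x \<in> carrier (ext_alg G)" "y \<in> carrier (ext_alg G)"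
    then show "x \<otimes>\<^bsub>ext_alg G\<^esub> y \<in> carrier (ext_alg G)"
      using ext_mult_support[of x G y] by (auto simp: ext_alg_def)
  next
    fix x :: "'a set \<Rightarrow> 'k" assume "x \<in> carrier (ext_alg G)"
    then have "\<And>S. x S \<noteq> 0 \<Longrightarrow> finite S"
      using assms by (auto simp: ext_alg_def intro: finite_subset)
    then show "\<one>\<^bsub>ext_alg G\<^esub> \<otimes>\<^bsub>ext_alg G\<^esub> x = x" "x \<otimes>\<^bsub>ext_alg G\<^esub> \<one>\<^bsub>ext_alg G\<^esub> = x"
      by (simp_all add: ext_alg_def ext_mult_one_left ext_mult_one_right)
  qed (auto simp: ext_alg_def ext_basis_def ext_mult_assoc)
qed (auto simp: ext_alg_def ext_mult_def distrib_left distrib_right sum.distrib)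

lemma ext_mult_basis:
  assumes "finite A" "finite B"
  shows "ext_mult (ext_basis A) (ext_basis B) =
    (\<lambda>S. if A \<inter> B = {} then ext_sign A B * ext_basis (A \<union> B) S else (0 :: 'k::field))"
proof
  fix S
  have *: "ext_sign T (S - T) * ext_basis A T * ext_basis B (S - T) =
      (if T = A then (if S - A = B then ext_sign A B else 0) else (0 :: 'k))" for T
    by (auto simp: ext_basis_def)
  show "ext_mult (ext_basis A) (ext_basis B) S =
    (if A \<inter> B = {} then ext_sign A B * ext_basis (A \<union> B) S else (0 :: 'k))"
  proof (cases "finite S")
    case True
    then show ?thesis
      unfolding ext_mult_def * by (auto simp: ext_basis_def)
  next
    case False
    then show ?thesis using assms by (auto simp: ext_mult_def ext_basis_def)
  qed
qed

lemma ext_basis_sq_zero: "ext_mult (ext_basis {i}) (ext_basis {i}) = (\<lambda>_. 0 :: 'k::field)"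
  by (simp add: ext_mult_basis)

lemma ext_basis_anticommute:
  assumes "i \<noteq> j"
  shows "ext_mult (ext_basis {i}) (ext_basis {j}) S =
    - (ext_mult (ext_basis {j}) (ext_basis {i}) S :: 'k::field)"
  using assms ext_sign_swap[of "{j}" i, where 'k = 'k]
  by (simp add: ext_mult_basis insert_commute)

lemma ext_basis_insert_less:
  assumes "finite S" "\<And>j. j \<in> S \<Longrightarrow> i < j"
  shows "ext_basis (insert i S) = ext_mult (ext_basis {i}) (ext_basis S :: 'a::linorder set \<Rightarrow> 'k::field)"
proof -
  have "i \<notin> S" using assms(2) by auto
  moreover have "{(s, t). s \<in> {i} \<and> t \<in> S \<and> t < s} = {}"
    using assms(2) by fastforce
  then have "ext_sign {i} S = (1 :: 'k)"
    by (simp only: ext_sign_def card.empty power_0)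
  ultimately show ?thesis using assms(1) by (auto simp: ext_mult_basis)
qed

lemma ext_der_basis:
  assumes "finite G" "C \<subseteq> G"
  shows "ext_der G (ext_basis C) =
    (\<lambda>S. \<Sum>i\<in>C. ext_sign {i} (C - {i}) * (ext_basis (C - {i}) S :: 'k::field))"
proof
  fix S
  have "ext_der G (ext_basis C) S =
      (\<Sum>i\<in>G. if i \<in> C \<and> S = C - {i} then ext_sign {i} (C - {i}) else (0 :: 'k))"
    unfolding ext_der_def using assms
    by (intro sum.mono_neutral_cong_left) (auto simp: ext_basis_def)
  also have "\<dots> = (\<Sum>i\<in>C. ext_sign {i} (C - {i}) * ext_basis (C - {i}) S)"
    using assms by (intro sum.mono_neutral_cong_right) (auto simp: ext_basis_def)
  finally show "ext_der G (ext_basis C) S =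
    (\<Sum>i\<in>C. ext_sign {i} (C - {i}) * (ext_basis (C - {i}) S :: 'k))" .
qed

lemma ext_der_generator:
  assumes "finite G" "i \<in> G"
  shows "ext_der G (ext_basis {i}) = (\<one>\<^bsub>ext_alg G\<^esub> :: _ \<Rightarrow> 'k::field)"
  using assms by (simp add: ext_der_basis ext_alg_def)

lemma ext_der_leibniz:
  fixes f g :: "'a::linorder set \<Rightarrow> 'k::field"
  assumes G: "finite G" and f: "f \<in> ext_deg G p" and S: "S \<subseteq> G"
  shows "ext_der G (ext_mult f g) S =
    ext_mult (ext_der G f) g S + (- 1) ^ p * ext_mult f (ext_der G g) S"
proof -
  have finS: "finite S" using G S finite_subset by auto
  note fin = finite_subset[OF _ finS]
  define eps :: "'a \<Rightarrow> 'a set \<Rightarrow> 'k" where "eps i T = ext_sign {i} T" for i T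
  define L1 where "L1 = (\<Sum>i\<in>G - S. \<Sum>T\<in>Pow S.
    eps i T * ext_sign T (S - T) * f (insert i T) * g (S - T))"
  define L2 where "L2 = (\<Sum>i\<in>G - S. \<Sum>T\<in>Pow S.
    (- 1) ^ p * eps i (S - T) * ext_sign T (S - T) * f T * g (insert i (S - T)))"
  define X1 where "X1 = (\<Sum>T\<in>Pow S. \<Sum>i\<in>S - T.
    eps i T * ext_sign T (S - T) * f (insert i T) * g (S - T))"
  define X2 where "X2 = (\<Sum>T\<in>Pow S. \<Sum>i\<in>T.
    (- 1) ^ p * eps i (S - T) * ext_sign T (S - T) * f T * g (insert i (S - T)))"
  have deg: "f T = 0 \<or> card T = p" for T
    using f by (auto simp: ext_deg_def)
  have "ext_der G (ext_mult f g) S = L1 + L2"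
  proof -
    have "ext_sign {i} S * ext_mult f g (insert i S) =
       (\<Sum>T\<in>Pow S. eps i T * ext_sign T (S - T) * f (insert i T) * g (S - T)) +
       (\<Sum>T\<in>Pow S. (- 1) ^ p * eps i (S - T) * ext_sign T (S - T) * f T * g (insert i (S - T)))"
      if i: "i \<in> G - S" for i
    proof -
      let ?t = "\<lambda>T. eps i S * (ext_sign T (insert i S - T) * f T * g (insert i S - T))"
      have "ext_sign {i} S * ext_mult f g (insert i S) = (\<Sum>T\<in>Pow (insert i S). ?t T)"
        by (simp add: ext_mult_def sum_distrib_left eps_def)
      also have "\<dots> = (\<Sum>T\<in>Pow S. ?t T) + (\<Sum>T\<in>insert i ` Pow S. ?t T)"
        unfolding Pow_insert using finS i by (intro sum.union_disjoint) auto
      also have "(\<Sum>T\<in>insert i ` Pow S. ?t T) = (\<Sum>T\<in>Pow S. ?t (insert i T))"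
        using i by (subst sum.reindex) (auto simp: inj_on_def)
      also have "\<dots> = (\<Sum>T\<in>Pow S. eps i T * ext_sign T (S - T) * f (insert i T) * g (S - T))"
      proof (rule sum.cong[OF refl])
        fix T assume "T \<in> Pow S"
        then have T: "T \<subseteq> S" and iT: "i \<notin> T" using i by auto
        have e: "insert i S - insert i T = S - T" using i by auto
        have 1: "ext_sign (insert i T) (S - T) = eps i (S - T) * ext_sign T (S - T)"
          using ext_sign_Un_left[of "{i}" T "S - T"] iT fin[OF T] finS by (simp add: eps_def)
        have 2: "eps i S = eps i T * eps i (S - T)"
          using ext_sign_Un_right[of "{i}" T "S - T"] T fin[OF T] finS
          by (simp add: eps_def Un_absorb1)
        have "eps i S * ext_sign (insert i T) (S - T) = eps i T * ext_sign T (S - T)"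
          using ext_sign_sq[of "{i}" "S - T", where 'k = 'k, folded eps_def]
          by (simp add: 1 2 mult_ac)
        then show "?t (insert i T) = eps i T * ext_sign T (S - T) * f (insert i T) * g (S - T)"
          unfolding e by (simp add: mult.assoc[symmetric])
      qed
      also have "(\<Sum>T\<in>Pow S. ?t T) = (\<Sum>T\<in>Pow S.
          (- 1) ^ p * eps i (S - T) * ext_sign T (S - T) * f T * g (insert i (S - T)))"
      proof (rule sum.cong[OF refl])
        fix T assume "T \<in> Pow S"
        then have T: "T \<subseteq> S" and iT: "i \<notin> T" using i by auto
        have e: "insert i S - T = insert i (S - T)" using iT by auto
        have 1: "ext_sign T (insert i (S - T)) = ext_sign T {i} * (ext_sign T (S - T) :: 'k)"
          using ext_sign_Un_right[of T "{i}" "S - T"] i fin[OF T] finS by simp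
        have 2: "eps i S = eps i T * eps i (S - T)"
          using ext_sign_Un_right[of "{i}" T "S - T"] T fin[OF T] finS
          by (simp add: eps_def Un_absorb1)
        have 3: "ext_sign T {i} = (- 1) ^ card T * eps i T"
          using ext_sign_swap[OF fin[OF T] iT] by (simp add: eps_def)
        have sq: "eps i T * (eps i T * z) = z" for z
          using ext_sign_sq[of "{i}" T, where 'k = 'k] by (simp add: eps_def mult.assoc[symmetric])
        show "?t T = (- 1) ^ p * eps i (S - T) * ext_sign T (S - T) * f T * g (insert i (S - T))"
          using deg[of T] by (auto simp: e 1 2 3 sq mult_ac)
      qed
      finally show ?thesis by (simp add: add.commute)
    qed
    then show ?thesis
      unfolding ext_der_def L1_def L2_def by (simp add: sum.distrib)
  qed
  moreover have "ext_mult (ext_der G f) g S = L1 + X1"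
  proof -
    have "ext_mult (ext_der G f) g S = (\<Sum>T\<in>Pow S. \<Sum>i\<in>G - T.
        eps i T * ext_sign T (S - T) * f (insert i T) * g (S - T))"
      by (simp add: ext_mult_def ext_der_def sum_distrib_left sum_distrib_right eps_def mult_ac)
    also have "\<dots> = (\<Sum>T\<in>Pow S. (\<Sum>i\<in>G - S.
        eps i T * ext_sign T (S - T) * f (insert i T) * g (S - T)) + (\<Sum>i\<in>S - T.
        eps i T * ext_sign T (S - T) * f (insert i T) * g (S - T)))"
    proof (rule sum.cong[OF refl])
      fix T assume "T \<in> Pow S"
      then have "G - T = (G - S) \<union> (S - T)" using S by auto
      then show "(\<Sum>i\<in>G - T. eps i T * ext_sign T (S - T) * f (insert i T) * g (S - T)) =
        (\<Sum>i\<in>G - S. eps i T * ext_sign T (S - T) * f (insert i T) * g (S - T)) +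
        (\<Sum>i\<in>S - T. eps i T * ext_sign T (S - T) * f (insert i T) * g (S - T))"
        using G finS by (simp only:) (rule sum.union_disjoint, auto)
    qed
    also have "\<dots> = L1 + X1"
      by (simp add: sum.distrib L1_def X1_def sum.swap[of _ "Pow S" "G - S"])
    finally show ?thesis .
  qed
  moreover have "(- 1) ^ p * ext_mult f (ext_der G g) S = L2 + X2"
  proof -
    have "(- 1) ^ p * ext_mult f (ext_der G g) S = (\<Sum>T\<in>Pow S. \<Sum>i\<in>G - (S - T).
        (- 1) ^ p * eps i (S - T) * ext_sign T (S - T) * f T * g (insert i (S - T)))"
      by (simp add: ext_mult_def ext_der_def sum_distrib_left sum_distrib_right eps_def mult_ac)
    also have "\<dots> = (\<Sum>T\<in>Pow S. (\<Sum>i\<in>G - S.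
        (- 1) ^ p * eps i (S - T) * ext_sign T (S - T) * f T * g (insert i (S - T))) + (\<Sum>i\<in>T.
        (- 1) ^ p * eps i (S - T) * ext_sign T (S - T) * f T * g (insert i (S - T))))"
    proof (rule sum.cong[OF refl])
      fix T assume "T \<in> Pow S"
      then have T: "T \<subseteq> S" and "G - (S - T) = (G - S) \<union> T" using S by auto
      then show "(\<Sum>i\<in>G - (S - T).
          (- 1) ^ p * eps i (S - T) * ext_sign T (S - T) * f T * g (insert i (S - T))) =
        (\<Sum>i\<in>G - S.
          (- 1) ^ p * eps i (S - T) * ext_sign T (S - T) * f T * g (insert i (S - T))) +
        (\<Sum>i\<in>T.
          (- 1) ^ p * eps i (S - T) * ext_sign T (S - T) * f T * g (insert i (S - T)))"
        using G fin[OF T] by (simp only:) (rule sum.union_disjoint, auto)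
    qed
    also have "\<dots> = L2 + X2"
      by (simp add: sum.distrib L2_def X2_def sum.swap[of _ "Pow S" "G - S"])
    finally show ?thesis .
  qed
  moreover have "X1 = - X2"
  proof -
    have "X1 = (\<Sum>(T, i)\<in>Sigma (Pow S) (\<lambda>T. S - T).
        eps i T * ext_sign T (S - T) * f (insert i T) * g (S - T))"
      unfolding X1_def using finS by (intro sum.Sigma) auto
    also have "\<dots> = (\<Sum>(T, i)\<in>Sigma (Pow S) (\<lambda>T. T).
        - ((- 1) ^ p * eps i (S - T) * ext_sign T (S - T) * f T * g (insert i (S - T))))"
    proof (rule sum.reindex_bij_witness[where i = "\<lambda>(T, i). (T - {i}, i)"
          and j = "\<lambda>(T, i). (insert i T, i)"], goal_cases)
      case (5 x)
      then obtain T i where x: "x = (T, i)" and T: "T \<subseteq> S" and i: "i \<in> S" "i \<notin> T"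
        by auto
      define R where "R = S - insert i T"
      have R: "S - T = insert i R" "i \<notin> R" "finite R" "S - insert i T = R"
        using i finS by (auto simp: R_def)
      have 1: "ext_sign T (insert i R) = (- 1) ^ card T * eps i T * ext_sign T R"
        using ext_sign_Un_right[of T "{i}" R, where 'k = 'k] R fin[OF T] ext_sign_swap[OF fin[OF T] i(2), where 'k = 'k]
        by (simp add: eps_def)
      have 2: "ext_sign (insert i T) R = eps i R * ext_sign T R"
        using ext_sign_Un_left[of "{i}" T R, where 'k = 'k] i R fin[OF T] by (simp add: eps_def)
      have sq: "eps i Y * (eps i Y * z) = z" for z Y
        using ext_sign_sq[of "{i}" Y, where 'k = 'k] by (simp add: eps_def mult.assoc[symmetric])
      have "card (insert i T) = Suc (card T)" using i fin[OF T] by simp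
      then have "f (insert i T) = 0 \<or> p = Suc (card T)"
        using deg[of "insert i T"] by auto
      then show ?case
        unfolding x by (auto simp: R 1 2 sq mult.assoc)
    qed auto
    also have "\<dots> = - X2"
      unfolding X2_def using finS
      by (subst sum.Sigma) (auto simp: sum_negf case_prod_unfold intro: fin)
    finally show ?thesis .
  qed
  ultimately show ?thesis by simp
qed

end

theory Submission
  imports Defs
begin

text \<open>
  Write \<open>A = E/I\<close> and identify the dual of \<open>A\<close> with the annihilator \<open>F\<close> of \<open>I\<close> inside the functions
  on subsets of \<open>G\<close>. The diagonal map \<open>\<phi> \<mapsto> (\<Sum>T. v\<^sub>T \<phi>(T) e\<^sub>T)\<close>, where \<open>v\<^sub>T\<close> is the product of the \<open>v\<^sub>i\<close>
  with \<open>i \<in> T\<close>, induces a map \<open>S\<close> from \<open>F\<close> to \<open>A\<close> (the contravariant form of Schechtman and Varchenko)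
  that turns right multiplication by \<open>u = (\<Sum>i. e\<^sub>i)\<close> into right multiplication by \<open>v\<close>.

  Suppose that no irreducible flat of rank at most \<open>m\<close> has \<open>v\<close>-sum zero. Then \<open>S\<close> is surjective in degrees
  up to \<open>m\<close>, by induction on the degree: if \<open>T\<close> is independent with closure \<open>X\<close> and \<open>Y\<close> is a connected
  component of \<open>X\<close>, then \<open>e\<^sub>T v\<^sub>X = 0\<close> in \<open>A\<close>, where \<open>v\<^sub>X = (\<Sum>i\<in>X. v\<^sub>i e\<^sub>i)\<close>. The derivation that is \<open>1\<close> on
  the generators in \<open>Y\<close> and \<open>0\<close> on the others preserves the relations supported on \<open>X\<close>, and applying it
  expresses \<open>(\<Sum>i\<in>Y. v\<^sub>i) e\<^sub>T\<close> through elements of smaller degree. As the form is symmetric, \<open>S\<close> is also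
  injective in these degrees.

  For \<open>m = p + 1\<close>, a cocycle of degree \<open>p\<close> is \<open>S \<phi>\<close> with \<open>\<phi> u = 0\<close>. The contraction by one generator is
  a contracting homotopy for multiplication by \<open>u\<close>, so \<open>\<phi> = \<psi> u\<close> and \<open>S \<phi> = S \<psi> v\<close> is a coboundary.
  When \<open>(\<Sum>i. v\<^sub>i) \<noteq> 0\<close>, the derivation \<open>\<partial>\<close> itself is a contracting homotopy.
\<close>

section \<open>Right multiplication by a vector and right derivations\<close>

text \<open>
  \<open>rmul v f\<close> is the product of \<open>f\<close> with \<open>\<Sum>i. v\<^sub>i e\<^sub>i\<close>, and \<open>rder Y\<close> is the derivation with \<open>e\<^sub>i \<mapsto> 1\<close> for
  \<open>i \<in> Y\<close> and \<open>e\<^sub>i \<mapsto> 0\<close> otherwise, acting from the right: then no signs depending on degrees occur.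
\<close>

definition rmul :: "('a::linorder \<Rightarrow> 'k::field) \<Rightarrow> ('a set \<Rightarrow> 'k) \<Rightarrow> 'a set \<Rightarrow> 'k" where
  "rmul v f = (\<lambda>S. \<Sum>i\<in>S. ext_sign (S - {i}) {i} * v i * f (S - {i}))"

definition rder :: "'a::linorder set \<Rightarrow> ('a set \<Rightarrow> 'k::field) \<Rightarrow> 'a set \<Rightarrow> 'k" where
  "rder Y f = (\<lambda>S. \<Sum>i\<in>Y - S. ext_sign S {i} * f (insert i S))"

lemma ext_sign_sq' [simp]: "ext_sign S T * (ext_sign S T * x) = (x :: 'k::field)"
  by (simp flip: mult.assoc)

lemma ext_sign_pair:
  assumes "i \<noteq> j"
  shows "ext_sign {i} {j} = - (ext_sign {j} {i} :: 'k::field)"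
  using ext_sign_swap[of "{i}" j, where 'k = 'k] assms by simp

text \<open>Appending i and then extracting j gives the opposite sign to the reverse order, because
  the two generators anticommute. This cancels the mixed terms in \<open>rder_rmul\<close>.\<close>

lemma ext_sign_exchange:
  assumes "finite S" "j \<in> S" "i \<notin> S"
  shows "ext_sign S {i} * ext_sign (insert i (S - {j})) {j} =
    - (ext_sign (S - {j}) {j} * ext_sign (S - {j}) {i} :: 'k::field)"
proof -
  define R where "R = S - {j}"
  have R: "S = insert j R" "finite R" "j \<notin> R" "i \<notin> R" "i \<noteq> j"
    using assms by (auto simp: R_def)
  have 1: "ext_sign S {i} = (ext_sign {j} {i} * ext_sign R {i} :: 'k)"
    using ext_sign_Un_left[of "{j}" R "{i}", where 'k = 'k] R by simp
  have 2: "ext_sign (insert i R) {j} = (ext_sign {i} {j} * ext_sign R {j} :: 'k)"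
    using ext_sign_Un_left[of "{i}" R "{j}", where 'k = 'k] R by simp
  show ?thesis
    using ext_sign_pair[OF R(5), where 'k = 'k]
    unfolding R_def[symmetric] 1 2 by (simp add: mult_ac)
qed

text \<open>Leibniz rule for the product of f with a vector, as the derivation sends the vector to
  its sum over Y. It is the Clifford relation between contraction and multiplication; the
  contracting homotopies below are instances of it.\<close>

lemma rder_rmul:
  fixes f :: "'a::linorder set \<Rightarrow> 'k::field"
  assumes Y: "finite Y" and S: "finite S"
  shows "rder Y (rmul v f) S + rmul v (rder Y f) S = (\<Sum>i\<in>Y. v i) * f S"
proof -
  \<comment> \<open>The mixed terms: j leaves S and i enters. They occur with a minus sign in the
    first summand and a plus sign in the second.\<close>
  define t where "t i j = ext_sign (S - {j}) {j} * (ext_sign (S - {j}) {i} * v j *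
    f (insert i (S - {j})))" for i j
  have 1: "ext_sign S {i} * rmul v f (insert i S) = v i * f S - (\<Sum>j\<in>S. t i j)"
    if i: "i \<in> Y - S" for i
  proof -
    have "ext_sign S {i} * rmul v f (insert i S) = ext_sign S {i} * (ext_sign S {i} * v i * f S) +
      (\<Sum>j\<in>S. ext_sign S {i} * (ext_sign (insert i S - {j}) {j} * v j * f (insert i S - {j})))"
      using S i by (simp add: rmul_def distrib_left sum_distrib_left)
    also have "(\<Sum>j\<in>S. ext_sign S {i} * (ext_sign (insert i S - {j}) {j} * v j * f (insert i S - {j})))
      = (\<Sum>j\<in>S. - t i j)"
    proof (rule sum.cong[OF refl])
      fix j assume j: "j \<in> S"
      have e: "insert i S - {j} = insert i (S - {j})" using i j by auto
      have "ext_sign S {i} * (ext_sign (insert i S - {j}) {j} * v j * f (insert i S - {j})) =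
        (ext_sign S {i} * ext_sign (insert i (S - {j})) {j}) * (v j * f (insert i (S - {j})))"
        by (simp only: e mult.assoc)
      also have "\<dots> = - t i j"
        using i j S by (subst ext_sign_exchange) (auto simp: t_def mult_ac)
      finally show "ext_sign S {i} * (ext_sign (insert i S - {j}) {j} * v j * f (insert i S - {j}))
        = - t i j" .
    qed
    finally show ?thesis by (simp add: mult.assoc sum_negf)
  qed
  have 2: "ext_sign (S - {j}) {j} * v j * rder Y f (S - {j}) =
      (if j \<in> Y then v j * f S else 0) + (\<Sum>i\<in>Y - S. t i j)" if j: "j \<in> S" for j
  proof -
    have "rder Y f (S - {j}) = (if j \<in> Y then ext_sign (S - {j}) {j} * f S else 0) +
      (\<Sum>i\<in>Y - S. ext_sign (S - {j}) {i} * f (insert i (S - {j})))"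
    proof (cases "j \<in> Y")
      case True
      then have "Y - (S - {j}) = insert j (Y - S)" using j by auto
      then show ?thesis using j Y True by (simp add: rder_def insert_absorb)
    next
      case False
      then have "Y - (S - {j}) = Y - S" using j by auto
      then show ?thesis using False by (simp add: rder_def)
    qed
    then show ?thesis
      by (simp add: t_def distrib_left sum_distrib_left mult_ac)
  qed
  have "rder Y (rmul v f) S = (\<Sum>i\<in>Y - S. v i * f S) - (\<Sum>i\<in>Y - S. \<Sum>j\<in>S. t i j)"
    using 1 by (simp add: rder_def sum_subtractf)
  also have "(\<Sum>i\<in>Y - S. \<Sum>j\<in>S. t i j) = (\<Sum>j\<in>S. \<Sum>i\<in>Y - S. t i j)"
    by (rule sum.swap)
  finally have 3: "rder Y (rmul v f) S =
      (\<Sum>i\<in>Y - S. v i * f S) - (\<Sum>j\<in>S. \<Sum>i\<in>Y - S. t i j)" .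
  have "rmul v (rder Y f) S =
      (\<Sum>j\<in>S. if j \<in> Y then v j * f S else 0) + (\<Sum>j\<in>S. \<Sum>i\<in>Y - S. t i j)"
    using 2 by (simp add: rmul_def sum.distrib)
  also have "(\<Sum>j\<in>S. if j \<in> Y then v j * f S else 0) = (\<Sum>j\<in>Y \<inter> S. v j * f S)"
    using S by (subst Int_commute) (simp add: sum.inter_restrict)
  finally have 4: "rmul v (rder Y f) S =
      (\<Sum>j\<in>Y \<inter> S. v j * f S) + (\<Sum>j\<in>S. \<Sum>i\<in>Y - S. t i j)" .
  have "(\<Sum>j\<in>Y \<inter> S. v j * f S) + (\<Sum>i\<in>Y - S. v i * f S) = (\<Sum>i\<in>Y. v i) * f S"
    using sum.Int_Diff[OF Y, of "\<lambda>i. v i * f S" S] by (simp add: sum_distrib_right)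
  then show ?thesis
    unfolding 3 4 by (simp add: algebra_simps)
qed

lemma rmul_add: "rmul v (\<lambda>S. f S + g S) = (\<lambda>S. rmul v f S + rmul v g S)"
  by (simp add: rmul_def distrib_left sum.distrib)

lemma rmul_diff: "rmul v (\<lambda>S. f S - g S) = (\<lambda>S. rmul v f S - rmul v g S)"
  by (simp add: rmul_def right_diff_distrib sum_subtractf)

lemma rmul_scale: "rmul v (\<lambda>S. c * f S) = (\<lambda>S. c * rmul v f S)"
  by (simp add: rmul_def sum_distrib_left mult_ac)

lemma rmul_sum: "rmul v (\<lambda>S. \<Sum>x\<in>A. f x S) = (\<lambda>S. \<Sum>x\<in>A. rmul v (f x) S)"
  unfolding rmul_def by (rule ext, subst sum.swap) (simp add: sum_distrib_left)

lemma rder_add: "rder Y (\<lambda>S. f S + g S) = (\<lambda>S. rder Y f S + rder Y g S)"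
  by (simp add: rder_def distrib_left sum.distrib)

lemma rder_scale: "rder Y (\<lambda>S. c * f S) = (\<lambda>S. c * rder Y f S)"
  by (simp add: rder_def sum_distrib_left mult_ac)

lemma rmul_nonzeroE:
  assumes "rmul v f S \<noteq> 0"
  obtains i where "i \<in> S" "finite S" "v i \<noteq> 0" "f (S - {i}) \<noteq> 0"
  using assms unfolding rmul_def
  by (metis (no_types, lifting) mult_eq_0_iff sum.infinite sum.neutral)

lemma rder_nonzeroE:
  assumes "rder Y f S \<noteq> 0"
  obtains i where "i \<in> Y - S" "f (insert i S) \<noteq> 0"
  using assms unfolding rder_def
  by (metis (no_types, lifting) mult_eq_0_iff sum.neutral)

text \<open>The vector u with all coefficients 1 has square zero. Contracting by the new element g
  and using the Clifford relation twice turns the claim for f on \<open>insert g R\<close> into the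
  claim for \<open>rder {g} f\<close> on R.\<close>

lemma rmul_rmul_one: "rmul (\<lambda>_. 1) (rmul (\<lambda>_. 1) f) S = (0 :: 'k::field)"
proof (cases "finite S")
  case False
  then show ?thesis by (simp add: rmul_def)
next
  case True
  let ?u = "\<lambda>_::'a. 1 :: 'k"
  show ?thesis using True
  proof (induction S arbitrary: f rule: finite_induct)
    case empty
    then show ?case by (simp add: rmul_def)
  next
    case (insert g R)
    have D: "rder {g} (rmul ?u h) T = h T - rmul ?u (rder {g} h) T" if "finite T" for h T
      using rder_rmul[of "{g}" T ?u h] that by (simp add: algebra_simps)
    have D': "rmul ?u (rder {g} (rmul ?u f)) R = rmul ?u (\<lambda>T. f T - rmul ?u (rder {g} f) T) R"
      unfolding rmul_def[of ?u "rder {g} (rmul ?u f)"]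
        rmul_def[of ?u "\<lambda>T. f T - rmul ?u (rder {g} f) T"]
      using insert.hyps by (intro sum.cong refl) (simp add: D)
    have "rder {g} (rmul ?u (rmul ?u f)) R = 0"
      using insert.hyps D[of R] D' insert.IH[of "rder {g} f"] by (simp add: rmul_diff)
    then have "ext_sign R {g} * rmul ?u (rmul ?u f) (insert g R) = 0"
      using insert.hyps by (simp add: rder_def insert_Diff_if)
    then show ?case by (simp add: ext_sign_def)
  qed
qed

section \<open>Duality between functionals and elements\<close>

definition pairing :: "'a set \<Rightarrow> ('a set \<Rightarrow> 'k::field) \<Rightarrow> ('a set \<Rightarrow> 'k) \<Rightarrow> 'k" where
  "pairing G \<phi> f = (\<Sum>T\<in>Pow G. \<phi> T * f T)"

text \<open>Pairs (T, i) with i outside T correspond to pairs (S, i) with i in S. As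
  \<open>rder G\<close> is adjoint to multiplication by u, vanishing on the derivatives of dependent
  sets becomes the condition on \<open>rmul (\<lambda>_. 1) \<phi>\<close> in
  \<open>osann\<close>.\<close>

lemma pairing_rder:
  assumes G: "finite G"
  shows "pairing G \<phi> (rder G f) = pairing G (rmul (\<lambda>_. 1) \<phi>) f"
proof -
  have "pairing G \<phi> (rder G f) =
      (\<Sum>(T, i)\<in>Sigma (Pow G) (\<lambda>T. G - T). \<phi> T * (ext_sign T {i} * f (insert i T)))"
    using G by (simp add: pairing_def rder_def sum_distrib_left sum.Sigma)
  also have "\<dots> = (\<Sum>(S, i)\<in>Sigma (Pow G) (\<lambda>S. S). ext_sign (S - {i}) {i} * 1 * \<phi> (S - {i}) * f S)"
    by (rule sum.reindex_bij_witness[where j = "\<lambda>(T, i). (insert i T, i)"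
          and i = "\<lambda>(S, i). (S - {i}, i)"]) (auto simp: insert_absorb)
  also have "\<dots> = pairing G (rmul (\<lambda>_. 1) \<phi>) f"
    using G by (auto simp: pairing_def rmul_def sum_distrib_right intro!: sum.Sigma[symmetric] intro: finite_subset)
  finally show ?thesis .
qed

lemma pairing_basis:
  assumes "finite G" "T \<subseteq> G"
  shows "pairing G (ext_basis T) f = f T" "pairing G f (ext_basis T) = f T"
  using assms by (simp_all add: pairing_def ext_basis_def if_distrib if_distribR cong: if_cong)

text \<open>Dual to \<open>rmul_rmul_one\<close>: pairing with \<open>ext_basis S\<close> moves both
  derivations to the other side.\<close>

lemma rder_rder:
  assumes G: "finite G" and S: "S \<subseteq> G"
  shows "rder G (rder G f) S = (0 :: 'k::field)"
proof -
  have "rder G (rder G f) S = pairing G (ext_basis S) (rder G (rder G f))"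
    using assms by (simp add: pairing_basis)
  also have "\<dots> = 0"
    unfolding pairing_rder[OF G] by (simp add: rmul_rmul_one pairing_def)
  finally show ?thesis .
qed

section \<open>Comparison with the exterior product and the graded derivation\<close>

text \<open>Only the sets T that lack exactly one element of S contribute. The vector is cut off
  because \<open>ext_vec G v\<close> reads v only on G.\<close>

lemma ext_mult_vec:
  fixes f :: "'a::linorder set \<Rightarrow> 'k::field"
  assumes G: "finite G"
  shows "ext_mult f (ext_vec G v) = rmul (\<lambda>i. if i \<in> G then v i else 0) f"
proof
  fix S
  show "ext_mult f (ext_vec G v) S = rmul (\<lambda>i. if i \<in> G then v i else 0) f S"
  proof (cases "finite S")
    case False
    then show ?thesis by (simp add: ext_mult_def rmul_def)
  next
    case S: True
    have vec: "ext_vec G v {i} = (if i \<in> G then v i else 0)" for i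
      using G by (simp add: ext_vec_def ext_basis_def if_distrib cong: if_cong)
    have vec0: "\<exists>i. R = {i}" if "ext_vec G v R \<noteq> 0" for R
    proof (rule ccontr)
      assume "\<nexists>i. R = {i}"
      then have "ext_vec G v R = 0"
        unfolding ext_vec_def ext_basis_def by (intro sum.neutral) auto
      then show False using that by simp
    qed
    have "ext_mult f (ext_vec G v) S =
        (\<Sum>T\<in>(\<lambda>i. S - {i}) ` S. ext_sign T (S - T) * f T * ext_vec G v (S - T))"
      unfolding ext_mult_def
    proof (rule sum.mono_neutral_right)
      show "\<forall>T\<in>Pow S - (\<lambda>i. S - {i}) ` S. ext_sign T (S - T) * f T * ext_vec G v (S - T) = 0"
      proof
        fix T assume T: "T \<in> Pow S - (\<lambda>i. S - {i}) ` S"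
        have "ext_vec G v (S - T) = 0"
        proof (rule ccontr)
          assume "ext_vec G v (S - T) \<noteq> 0"
          then obtain i where "S - T = {i}" using vec0 by auto
          then have "T = S - {i}" "i \<in> S" using T by auto
          then show False using T by auto
        qed
        then show "ext_sign T (S - T) * f T * ext_vec G v (S - T) = 0" by simp
      qed
    qed (use S in auto)
    also have "\<dots> = (\<Sum>i\<in>S. ext_sign (S - {i}) (S - (S - {i})) * f (S - {i}) * ext_vec G v (S - (S - {i})))"
      by (subst sum.reindex) (auto simp: inj_on_def)
    also have "\<dots> = rmul (\<lambda>i. if i \<in> G then v i else 0) f S"
      unfolding rmul_def
    proof (rule sum.cong[OF refl])
      fix i assume "i \<in> S"
      then have "S - (S - {i}) = {i}" by auto
      then show "ext_sign (S - {i}) (S - (S - {i})) * f (S - {i}) * ext_vec G v (S - (S - {i})) =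
        ext_sign (S - {i}) {i} * (if i \<in> G then v i else 0) * f (S - {i})"
        by (simp only: vec) (simp add: mult_ac)
    qed
    finally show ?thesis .
  qed
qed

text \<open>Moving the removed generator from one end of the product to the other costs one sign for
  each element of S.\<close>

lemma rder_eq_ext_der:
  assumes G: "finite G" and S: "finite S"
  shows "rder G f S = (- 1) ^ card S * (ext_der G f S :: 'k::field)"
  unfolding rder_def ext_der_def sum_distrib_left
  using S by (intro sum.cong) (auto simp: ext_sign_swap mult.assoc)

lemma rder_rmul_fun:
  fixes f :: "'a::linorder set \<Rightarrow> 'k::field"
  assumes "finite Y" "\<And>S. f S \<noteq> 0 \<Longrightarrow> finite S"
  shows "(\<lambda>S. rder Y (rmul v f) S + rmul v (rder Y f) S) = (\<lambda>S. (\<Sum>i\<in>Y. v i) * f S)"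
proof
  fix S
  show "rder Y (rmul v f) S + rmul v (rder Y f) S = (\<Sum>i\<in>Y. v i) * f S"
  proof (cases "finite S")
    case True
    then show ?thesis using rder_rmul[OF assms(1)] by blast
  next
    case False
    then have "f S = 0" using assms(2) by blast
    with False show ?thesis by (simp add: rder_def rmul_def)
  qed
qed

lemma rmul_rder_fun:
  fixes f :: "'a::linorder set \<Rightarrow> 'k::field"
  assumes "finite Y" "\<And>S. f S \<noteq> 0 \<Longrightarrow> finite S"
  shows "rmul v (rder Y f) = (\<lambda>S. (\<Sum>i\<in>Y. v i) * f S - rder Y (rmul v f) S)"
  using fun_cong[OF rder_rmul_fun[OF assms, where v = v]] by (auto simp: fun_eq_iff eq_diff_eq add.commute)

lemma rder_basis:
  assumes "finite Y"
  shows "rder Y (ext_basis T) = (\<lambda>S. \<Sum>j\<in>Y \<inter> T. ext_sign (T - {j}) {j} * (ext_basis (T - {j}) S :: 'k::field))"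
proof
  fix S
  have "rder Y (ext_basis T) S = (\<Sum>i\<in>Y. if i \<in> T \<and> S = T - {i} then ext_sign S {i} else (0 :: 'k))"
    unfolding rder_def using assms
    by (intro sum.mono_neutral_cong_left) (auto simp: ext_basis_def)
  also have "\<dots> = (\<Sum>j\<in>Y \<inter> T. ext_sign (T - {j}) {j} * ext_basis (T - {j}) S)"
    using assms by (intro sum.mono_neutral_cong_right) (auto simp: ext_basis_def)
  finally show "rder Y (ext_basis T) S =
    (\<Sum>j\<in>Y \<inter> T. ext_sign (T - {j}) {j} * (ext_basis (T - {j}) S :: 'k))" .
qed

section \<open>The diagonal map from functionals to elements\<close>

definition diag :: "('a \<Rightarrow> 'k::field) \<Rightarrow> ('a set \<Rightarrow> 'k) \<Rightarrow> 'a set \<Rightarrow> 'k" where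
  "diag v \<phi> = (\<lambda>S. (\<Prod>i\<in>S. v i) * \<phi> S)"

lemma diag_sum: "diag v (\<lambda>S. \<Sum>x\<in>A. f x S) = (\<lambda>S. \<Sum>x\<in>A. diag v (f x) S)"
  by (simp add: diag_def sum_distrib_left)

lemma diag_scale: "diag v (\<lambda>S. c * f S) = (\<lambda>S. c * diag v f S)"
  by (simp add: diag_def mult_ac)

text \<open>The factor \<open>v i\<close> supplied by the multiplication completes the product over
  S - {i} to the product over S. This is how multiplication by u becomes multiplication by
  v.\<close>

lemma rmul_diag: "rmul v (diag v \<phi>) = diag v (rmul (\<lambda>_. 1) \<phi>)"
proof
  fix S
  show "rmul v (diag v \<phi>) S = diag v (rmul (\<lambda>_. 1) \<phi>) S"
  proof (cases "finite S")
    case True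
    show ?thesis
      unfolding rmul_def diag_def sum_distrib_left
      using True by (intro sum.cong) (auto simp: prod.remove mult_ac)
  qed (simp add: rmul_def diag_def)
qed

text \<open>The contravariant form is symmetric, its matrix being diagonal; surjectivity will
  thereby give injectivity.\<close>

lemma pairing_diag: "pairing G \<phi> (diag v \<chi>) = pairing G \<chi> (diag v \<phi>)"
  by (simp add: pairing_def diag_def mult_ac)

section \<open>Closure and connected components in a matroid\<close>

context matroid begin

section \<open>Independent sets, bases and rank\<close>

lemma indep_finite: "A \<in> \<I> \<Longrightarrow> finite A"
  using indep_subset finite_ground finite_subset by blast

lemma finite_indeps: "finite \<I>"
  using finite_subset[of \<I> "Pow G"] indep_subset finite_ground by auto

lemma card_le_mrank: "A \<in> \<I> \<Longrightarrow> A \<subseteq> X \<Longrightarrow> card A \<le> mrank \<I> X"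
  unfolding mrank_def using finite_indeps by (intro Max_ge) auto

lemma mrank_witness: "\<exists>A\<in>\<I>. A \<subseteq> X \<and> card A = mrank \<I> X"
proof -
  have "mrank \<I> X \<in> card ` {A \<in> \<I>. A \<subseteq> X}"
    unfolding mrank_def using finite_indeps indep_empty by (intro Max_in) auto
  then show ?thesis by auto
qed

lemma mrank_mono: "X \<subseteq> Y \<Longrightarrow> mrank \<I> X \<le> mrank \<I> Y"
  using mrank_witness[of X] card_le_mrank by (metis subset_trans)

lemma extend_to_basis:
  assumes "A \<in> \<I>" "A \<subseteq> X"
  obtains B where "B \<in> \<I>" "A \<subseteq> B" "B \<subseteq> X" "card B = mrank \<I> X"
proof -
  let ?P = "\<lambda>B. B \<in> \<I> \<and> A \<subseteq> B \<and> B \<subseteq> X"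
  have "\<exists>B. is_arg_max card ?P B"
  proof -
    have "finite {B. ?P B}" "{B. ?P B} \<noteq> {}" using finite_indeps assms by auto
    then have "Max (card ` {B. ?P B}) \<in> card ` {B. ?P B}" by (intro Max_in) auto
    then obtain B where "?P B" "card B = Max (card ` {B. ?P B})" by force
    moreover have "card B' \<le> Max (card ` {B. ?P B})" if "?P B'" for B'
      using that \<open>finite {B. ?P B}\<close> by (intro Max_ge) auto
    ultimately show ?thesis by (auto simp: is_arg_max_linorder)
  qed
  then obtain B where B: "?P B" and max: "\<And>B'. ?P B' \<Longrightarrow> card B' \<le> card B"
    by (auto simp: is_arg_max_linorder)
  obtain M where M: "M \<in> \<I>" "M \<subseteq> X" "card M = mrank \<I> X" using mrank_witness by auto
  have "\<not> card B < card M"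
  proof
    assume "card B < card M"
    then obtain x where x: "x \<in> M - B" "insert x B \<in> \<I>" using indep_augment B M by blast
    then have "?P (insert x B)" using B M by auto
    from max[OF this] show False using x B indep_finite by simp
  qed
  moreover have "card B \<le> mrank \<I> X" using B card_le_mrank by auto
  ultimately show thesis using that B M by auto
qed

lemma mrank_eq_card_maximal:
  assumes "B \<in> \<I>" "B \<subseteq> X" and max: "\<And>x. x \<in> X - B \<Longrightarrow> insert x B \<notin> \<I>"
  shows "mrank \<I> X = card B"
proof -
  obtain B' where B': "B' \<in> \<I>" "B \<subseteq> B'" "B' \<subseteq> X" "card B' = mrank \<I> X"
    using extend_to_basis assms by blast
  have "B' = B"
  proof (rule ccontr)
    assume "B' \<noteq> B"
    then obtain x where "x \<in> B' - B" using B' by auto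
    then have "insert x B \<in> \<I>" using indep_mono[of B' "insert x B"] B' by auto
    then show False using max \<open>x \<in> B' - B\<close> B' by auto
  qed
  then show ?thesis using B' by simp
qed

section \<open>Circuits: existence, strong elimination and transitivity\<close>

lemma circuit_exists:
  assumes "D \<subseteq> G" "D \<notin> \<I>"
  obtains C where "C \<in> circuits G \<I>" "C \<subseteq> D"
proof -
  have "finite D" using assms finite_ground finite_subset by auto
  then have "\<exists>C\<in>circuits G \<I>. C \<subseteq> D" using assms
  proof (induction D rule: finite_psubset_induct)
    case (psubset D)
    show ?case
    proof (cases "\<exists>E. E \<subset> D \<and> E \<notin> \<I>")
      case True
      then show ?thesis using psubset by (metis psubset_imp_subset subset_trans)
    next
      case False
      then show ?thesis using psubset.prems by (auto simp: circuits_def)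
    qed
  qed
  then show thesis using that by auto
qed

lemma circuitD:
  assumes "C \<in> circuits G \<I>"
  shows "C \<subseteq> G" "C \<notin> \<I>" "finite C" "C \<noteq> {}" "\<And>x. x \<in> C \<Longrightarrow> C - {x} \<in> \<I>"
  using assms finite_subset[OF _ finite_ground] indep_empty by (auto simp: circuits_def)

lemma circuit_in_insert:
  assumes "B \<in> \<I>" "x \<in> G" "insert x B \<notin> \<I>"
  obtains C where "C \<in> circuits G \<I>" "C \<subseteq> insert x B" "x \<in> C"
proof -
  obtain C where C: "C \<in> circuits G \<I>" "C \<subseteq> insert x B"
    using circuit_exists[of "insert x B"] assms indep_subset by auto
  moreover have "x \<in> C"
    using C circuitD(2)[OF C(1)] indep_mono[OF assms(1), of C] by auto
  ultimately show thesis using that by auto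
qed

text \<open>A rank argument: C2 puts e into the closure of Z, and C1 puts x into the closure of
  \<open>insert e Z\<close>. Hence x is dependent on a basis B of Z, and the circuit through x in
  \<open>insert x B\<close> avoids e.\<close>

lemma strong_elimination:
  assumes C1: "C1 \<in> circuits G \<I>" and C2: "C2 \<in> circuits G \<I>"
    and e: "e \<in> C1 \<inter> C2" and x: "x \<in> C1 - C2"
  obtains C3 where "C3 \<in> circuits G \<I>" "C3 \<subseteq> C1 \<union> C2 - {e}" "x \<in> C3"
proof -
  define Z where "Z = C1 \<union> C2 - {e, x}"
  have "e \<noteq> x" using e x by auto
  have "C2 - {e} \<in> \<I>" "C2 - {e} \<subseteq> Z" using C2 e x circuitD by (auto simp: Z_def)
  \<comment> \<open>B contains C2 - {e}, so that adding e completes the circuit C2 and cannot raise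
    the rank.\<close>
  then obtain B where B: "B \<in> \<I>" "C2 - {e} \<subseteq> B" "B \<subseteq> Z" "card B = mrank \<I> Z"
    using extend_to_basis by blast
  have "mrank \<I> (insert e Z) = card B"
  proof (rule mrank_eq_card_maximal)
    fix z assume z: "z \<in> insert e Z - B"
    show "insert z B \<notin> \<I>"
    proof
      assume ins: "insert z B \<in> \<I>"
      show False
      proof (cases "z = e")
        case True
        then have "C2 \<subseteq> insert z B" using B by auto
        then show False using ins indep_mono circuitD(2)[OF C2] by blast
      next
        case False
        then have "card (insert z B) \<le> mrank \<I> Z"
          using z B ins by (intro card_le_mrank) auto
        then show False using z B indep_finite by simp
      qed
    qed
  qed (use B in auto)
  moreover have "C1 - {x} \<in> \<I>" "C1 - {x} \<subseteq> insert e Z" using C1 x circuitD by (auto simp: Z_def)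
  then obtain B' where B': "B' \<in> \<I>" "C1 - {x} \<subseteq> B'" "B' \<subseteq> insert e Z" "card B' = mrank \<I> (insert e Z)"
    using extend_to_basis by blast
  have "mrank \<I> (insert x (insert e Z)) = card B'"
  proof (rule mrank_eq_card_maximal)
    fix z assume z: "z \<in> insert x (insert e Z) - B'"
    show "insert z B' \<notin> \<I>"
    proof
      assume ins: "insert z B' \<in> \<I>"
      show False
      proof (cases "z = x")
        case True
        then have "C1 \<subseteq> insert z B'" using B' by auto
        then show False using ins indep_mono circuitD(2)[OF C1] by blast
      next
        case False
        then have "card (insert z B') \<le> mrank \<I> (insert e Z)"
          using z B' ins by (intro card_le_mrank) auto
        then show False using z B' indep_finite by simp
      qed
    qed
  qed (use B' in auto)
  ultimately have r: "mrank \<I> (insert x (insert e Z)) = card B" using B' by simp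
  have xB: "x \<notin> B" using B by (auto simp: Z_def)
  have "insert x B \<notin> \<I>"
  proof
    assume "insert x B \<in> \<I>"
    then have "card (insert x B) \<le> mrank \<I> (insert x (insert e Z))"
      using B by (intro card_le_mrank) auto
    then show False using r xB B indep_finite by simp
  qed
  moreover have "x \<in> G" using x circuitD(1)[OF C1] by auto
  ultimately obtain C3 where C3: "C3 \<in> circuits G \<I>" "C3 \<subseteq> insert x B" "x \<in> C3"
    using circuit_in_insert B by blast
  have "insert x B \<subseteq> C1 \<union> C2 - {e}" using B x \<open>e \<noteq> x\<close> by (auto simp: Z_def)
  then show thesis using that C3 by auto
qed

text \<open>Induction on the size of the union. Eliminate a common e twice, keeping x in C3 and y in
  C4. If C3 misses a point of C1 - C2, the pair C3, C2 has a smaller union; otherwise C4 meets C3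
  inside C1 - C2, and the union of C3 and C4 avoids e. The final inclusion keeps the new circuit
  inside a given flat.\<close>

lemma circuit_transitive:
  assumes "C1 \<in> circuits G \<I>" "C2 \<in> circuits G \<I>" "C1 \<inter> C2 \<noteq> {}" "x \<in> C1" "y \<in> C2"
  shows "\<exists>C\<in>circuits G \<I>. x \<in> C \<and> y \<in> C \<and> C \<subseteq> C1 \<union> C2"
  using assms
proof (induction "card (C1 \<union> C2)" arbitrary: C1 C2 rule: less_induct)
  case less
  note C1 = less.prems(1) and C2 = less.prems(2) and x = less.prems(4) and y = less.prems(5)
  show ?case
  proof (cases "x \<in> C2 \<or> y \<in> C1")
    case True
    then show ?thesis using C1 C2 x y by blast
  next
    case False
    obtain e where e: "e \<in> C1" "e \<in> C2" using less.prems(3) by auto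
    obtain C3 where C3: "C3 \<in> circuits G \<I>" "C3 \<subseteq> C1 \<union> C2 - {e}" "x \<in> C3"
      using strong_elimination[OF C1 C2, of e x] e x False by auto
    obtain C4 where C4: "C4 \<in> circuits G \<I>" "C4 \<subseteq> C2 \<union> C1 - {e}" "y \<in> C4"
      using strong_elimination[OF C2 C1, of e y] e y False by auto
    \<comment> \<open>A circuit minus a point is independent and contains no circuit; this forces
      the intersections needed for the induction hypothesis.\<close>
    have nsub: "\<not> C \<subseteq> C' - {e}" if "C \<in> circuits G \<I>" "C' \<in> circuits G \<I>" "e \<in> C'" for C C'
      using circuitD(2)[OF that(1)] circuitD(5)[OF that(2,3)] indep_mono by auto
    have fin: "finite (C1 \<union> C2)" using C1 C2 circuitD by simp
    have less': "card U < card (C1 \<union> C2)" if "U \<subseteq> C1 \<union> C2" "z \<in> C1 \<union> C2" "z \<notin> U" for U z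
      using that fin by (intro psubset_card_mono) auto
    have m3: "C3 \<inter> C2 \<noteq> {}" using nsub[OF C3(1) C1 e(1)] C3 by auto
    have m4: "C4 \<inter> C1 \<noteq> {}" using nsub[OF C4(1) C2 e(2)] C4 by auto
    show ?thesis
    proof (cases "C1 - C2 \<subseteq> C3")
      case False
      then obtain z where "z \<in> C1 - C2" "z \<notin> C3" by auto
      then have "card (C3 \<union> C2) < card (C1 \<union> C2)" using C3 by (intro less'[of _ z]) auto
      from less.hyps[OF this C3(1) C2 m3 C3(3) y] show ?thesis using C3 by blast
    next
      case True
      have "C4 \<inter> (C1 - C2) \<noteq> {}"
        using nsub[OF C4(1) C2 e(2)] C4 by auto
      then have m: "C3 \<inter> C4 \<noteq> {}" using True by auto
      have "card (C3 \<union> C4) < card (C1 \<union> C2)" using C3 C4 e by (intro less'[of _ e]) auto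
      from less.hyps[OF this C3(1) C4(1) m C3(3) C4(3)] show ?thesis using C3 C4 by blast
    qed
  qed
qed

section \<open>Closures, flats and connected components\<close>

text \<open>This formula gives the matroid closure when T is independent, the case in which it is
  applied; for dependent T it gives all of G.\<close>

definition mcl :: "'a set \<Rightarrow> 'a set" where
  "mcl T = {x \<in> G. x \<in> T \<or> insert x T \<notin> \<I>}"

lemma
  assumes T: "T \<in> \<I>"
  shows mcl_superset: "T \<subseteq> mcl T"
    and mrank_mcl: "mrank \<I> (mcl T) = card T"
    and mcl_flat: "mcl T \<in> flats G \<I>"
proof -
  show sup: "T \<subseteq> mcl T" using indep_subset[OF T] by (auto simp: mcl_def)
  show r: "mrank \<I> (mcl T) = card T"
    by (rule mrank_eq_card_maximal[OF T sup]) (auto simp: mcl_def)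
  have "mrank \<I> (mcl T) < mrank \<I> (insert x (mcl T))" if x: "x \<in> G - mcl T" for x
  proof -
    have "x \<notin> T" "insert x T \<in> \<I>" using x by (auto simp: mcl_def)
    then have "card (insert x T) \<le> mrank \<I> (insert x (mcl T))"
      using sup by (intro card_le_mrank) auto
    then show ?thesis using r \<open>x \<notin> T\<close> indep_finite[OF T] by simp
  qed
  then show "mcl T \<in> flats G \<I>" by (auto simp: flats_def mcl_def)
qed

lemma mcl_mono: "S \<subseteq> T \<Longrightarrow> mcl S \<subseteq> mcl T"
  unfolding mcl_def using indep_mono[of "insert _ T" "insert _ S"] by auto

text \<open>Extend B to a basis of X and augment it from a basis of \<open>insert i X\<close>. The
  new element cannot lie in X, whose rank is already reached, so it is i.\<close>

lemma flat_augment: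
  assumes X: "X \<in> flats G \<I>" and B: "B \<in> \<I>" "B \<subseteq> X" and i: "i \<in> G - X"
  shows "insert i B \<in> \<I>"
proof -
  obtain B' where B': "B' \<in> \<I>" "B \<subseteq> B'" "B' \<subseteq> X" "card B' = mrank \<I> X"
    using extend_to_basis B by blast
  obtain A where A: "A \<in> \<I>" "A \<subseteq> insert i X" "card A = mrank \<I> (insert i X)"
    using mrank_witness by blast
  have "card B' < card A" using X i A B' by (auto simp: flats_def)
  then obtain z where z: "z \<in> A - B'" "insert z B' \<in> \<I>" using indep_augment A B' by blast
  have "z \<notin> X"
  proof
    assume "z \<in> X"
    then have "card (insert z B') \<le> mrank \<I> X" using z B' by (intro card_le_mrank) auto
    then show False using z B' indep_finite by simp
  qed
  then have "z = i" using z A by auto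
  then show ?thesis using z B' indep_mono[of "insert z B'" "insert i B"] by auto
qed

text \<open>Y is the class of x under the relation of lying on a common circuit inside X, an
  equivalence by \<open>circuit_transitive\<close>. The last property says that X splits as the
  direct sum of Y and its complement in X.\<close>

lemma component_exists:
  assumes X: "X \<in> flats G \<I>" and noloop: "\<And>y. y \<in> G \<Longrightarrow> {y} \<in> \<I>" and x: "x \<in> X"
  obtains Y where "Y \<subseteq> X" "Y \<in> irr_flats_le G \<I> (mrank \<I> X)"
    "\<And>C. C \<in> circuits G \<I> \<Longrightarrow> C \<subseteq> X \<Longrightarrow> C \<inter> Y \<noteq> {} \<Longrightarrow> C \<subseteq> Y"
proof -
  define Y where "Y = {y \<in> X. y = x \<or> (\<exists>C\<in>circuits G \<I>. C \<subseteq> X \<and> x \<in> C \<and> y \<in> C)}"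
  have XG: "X \<subseteq> G" using X by (auto simp: flats_def)
  have YX: "Y \<subseteq> X" by (auto simp: Y_def)
  have sep: "C \<subseteq> Y" if C: "C \<in> circuits G \<I>" "C \<subseteq> X" "C \<inter> Y \<noteq> {}" for C
  proof
    fix y assume y: "y \<in> C"
    obtain z where z: "z \<in> C" "z \<in> Y" using C by auto
    have "\<exists>C'\<in>circuits G \<I>. C' \<subseteq> X \<and> x \<in> C' \<and> y \<in> C'"
    proof (cases "z = x")
      case True
      then show ?thesis using C y z by auto
    next
      case False
      then obtain C1 where C1: "C1 \<in> circuits G \<I>" "C1 \<subseteq> X" "x \<in> C1" "z \<in> C1"
        using z by (auto simp: Y_def)
      then show ?thesis using circuit_transitive[OF C1(1) C(1) _ C1(3) y] z C by blast
    qed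
    then show "y \<in> Y" using y C by (auto simp: Y_def)
  qed
  have flat: "Y \<in> flats G \<I>"
  proof -
    have "mrank \<I> Y < mrank \<I> (insert y Y)" if y: "y \<in> G - Y" for y
    proof -
      obtain B where B: "B \<in> \<I>" "B \<subseteq> Y" "card B = mrank \<I> Y"
        using mrank_witness by blast
      have "insert y B \<in> \<I>"
      proof (cases "y \<in> X")
        case False
        then show ?thesis using flat_augment[OF X B(1)] B YX y by auto
      next
        case True
        show ?thesis
        proof (rule ccontr)
          assume "insert y B \<notin> \<I>"
          then obtain C where C: "C \<in> circuits G \<I>" "C \<subseteq> insert y B" "y \<in> C"
            using circuit_in_insert B y by blast
          \<comment> \<open>As there are no loops, C has a second element; it lies in B, hence in
            Y.\<close>
          have "C \<noteq> {y}" using C noloop y circuitD(2) by blast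
          then have "C \<inter> Y \<noteq> {}" using C B by auto
          then have "C \<subseteq> Y" using sep C True B YX by blast
          then show False using C y by auto
        qed
      qed
      then have "card (insert y B) \<le> mrank \<I> (insert y Y)"
        using B by (intro card_le_mrank) auto
      then show ?thesis using B y indep_finite[OF B(1)] by (subst (asm) card_insert_disjoint) auto
    qed
    then show ?thesis using YX XG by (auto simp: flats_def)
  qed
  have circ: "C \<in> circuits Y (mrestrict \<I> Y)" if "C \<in> circuits G \<I>" "C \<subseteq> Y" for C
    using that by (auto simp: circuits_def mrestrict_def)
  have "mconnected Y (mrestrict \<I> Y)"
    unfolding mconnected_def
  proof (intro ballI impI)
    fix y z assume yz: "y \<in> Y" "z \<in> Y" "y \<noteq> z"
    have "\<exists>C\<in>circuits G \<I>. C \<subseteq> X \<and> y \<in> C \<and> z \<in> C"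
    proof (cases "y = x \<or> z = x")
      case True
      then show ?thesis using yz by (auto simp: Y_def)
    next
      case False
      obtain C1 where C1: "C1 \<in> circuits G \<I>" "C1 \<subseteq> X" "x \<in> C1" "y \<in> C1"
        using False yz by (auto simp: Y_def)
      obtain C2 where C2: "C2 \<in> circuits G \<I>" "C2 \<subseteq> X" "x \<in> C2" "z \<in> C2"
        using False yz by (auto simp: Y_def)
      show ?thesis using circuit_transitive[OF C1(1) C2(1) _ C1(4) C2(4)] C1 C2 by blast
    qed
    then obtain C where C: "C \<in> circuits G \<I>" "C \<subseteq> X" "y \<in> C" "z \<in> C" by auto
    then have "C \<subseteq> Y" using sep yz by auto
    then show "\<exists>C\<in>circuits Y (mrestrict \<I> Y). y \<in> C \<and> z \<in> C" using circ C by auto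
  qed
  then have "Y \<in> irr_flats_le G \<I> (mrank \<I> X)"
    using flat mrank_mono[OF YX] x by (auto simp: irr_flats_le_def Y_def)
  then show thesis using that YX sep by auto
qed

end

section \<open>The Orlik--Solomon relations and their annihilator\<close>

locale ordered_matroid = matroid G \<I> for G :: "'a::linorder set" and \<I>
begin

definition dep_supp :: "('a set \<Rightarrow> 'k::field) \<Rightarrow> bool" where
  "dep_supp f \<longleftrightarrow> (\<forall>S. f S \<noteq> 0 \<longrightarrow> S \<subseteq> G \<and> S \<notin> \<I>)"

text \<open>The ideal as a linear span: the \<open>e_D\<close> with D dependent together with their
  derivatives. In this form membership is a question of supports; equality with the generated ideal
  is \<open>os_ideal_eq\<close>.\<close>

definition osrel :: "('a set \<Rightarrow> 'k::field) set" where
  "osrel = {\<lambda>S. a S + rder G b S | a b. dep_supp a \<and> dep_supp b}"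

text \<open>The space \<open>F\<close>: functionals on \<open>E\<close>, given by their values on the \<open>e\<^sub>D\<close>, that vanish on the ideal.\<close>

definition osann :: "('a set \<Rightarrow> 'k::field) \<Rightarrow> bool" where
  "osann \<phi> \<longleftrightarrow> (\<forall>D\<subseteq>G. D \<notin> \<I> \<longrightarrow> \<phi> D = 0 \<and> rmul (\<lambda>_. 1) \<phi> D = 0)"

section \<open>Closure properties of the space of relations\<close>

lemma finite_subG: "S \<subseteq> G \<Longrightarrow> finite S"
  using finite_ground finite_subset by auto

lemma osrelI: "dep_supp a \<Longrightarrow> dep_supp b \<Longrightarrow> f = (\<lambda>S. a S + rder G b S) \<Longrightarrow> f \<in> osrel"
  by (auto simp: osrel_def)

lemma osrelE:
  assumes "f \<in> osrel"
  obtains a b where "dep_supp a" "dep_supp b" "f = (\<lambda>S. a S + rder G b S)"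
  using assms by (auto simp: osrel_def)

lemma dep_supp_zero [simp]: "dep_supp (\<lambda>_. 0)"
  by (simp add: dep_supp_def)

lemma dep_supp_add: "dep_supp f \<Longrightarrow> dep_supp g \<Longrightarrow> dep_supp (\<lambda>S. f S + g S)"
  unfolding dep_supp_def by (metis add_0)

lemma dep_supp_scale: "dep_supp f \<Longrightarrow> dep_supp (\<lambda>S. c * f S)"
  unfolding dep_supp_def by auto

lemma dep_supp_rmul:
  assumes f: "dep_supp f" and v: "\<And>i. v i \<noteq> 0 \<Longrightarrow> i \<in> G"
  shows "dep_supp (rmul v f)"
  unfolding dep_supp_def
proof (intro allI impI)
  fix S assume "rmul v f S \<noteq> 0"
  then obtain i where i: "i \<in> S" "v i \<noteq> 0" "f (S - {i}) \<noteq> 0" by (rule rmul_nonzeroE)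
  then have "S - {i} \<subseteq> G" "S - {i} \<notin> \<I>" using f by (auto simp: dep_supp_def)
  then show "S \<subseteq> G \<and> S \<notin> \<I>" using v i indep_mono[of S "S - {i}"] by auto
qed

lemma rder_zero: "rder Y (\<lambda>_. 0) = (\<lambda>_. 0)"
  by (simp add: rder_def)

lemma osrel_dep: "dep_supp f \<Longrightarrow> f \<in> osrel"
  by (rule osrelI[of f "\<lambda>_. 0"]) (simp_all add: rder_zero)

lemma osrel_rder: "dep_supp f \<Longrightarrow> rder G f \<in> osrel"
  by (rule osrelI[of "\<lambda>_. 0" f]) simp_all

lemma osrel_zero: "(\<lambda>_. 0) \<in> osrel"
  by (rule osrel_dep) simp

lemma osrel_add:
  assumes "f \<in> osrel" "g \<in> osrel"
  shows "(\<lambda>S. f S + g S) \<in> osrel"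
proof -
  obtain a b where f: "dep_supp a" "dep_supp b" "f = (\<lambda>S. a S + rder G b S)"
    using assms(1) by (rule osrelE)
  obtain c d where g: "dep_supp c" "dep_supp d" "g = (\<lambda>S. c S + rder G d S)"
    using assms(2) by (rule osrelE)
  show ?thesis
    by (rule osrelI[of "\<lambda>S. a S + c S" "\<lambda>S. b S + d S"])
       (use f g in \<open>simp_all add: dep_supp_add rder_add add_ac\<close>)
qed

lemma osrel_scale:
  assumes "f \<in> osrel"
  shows "(\<lambda>S. c * f S) \<in> osrel"
proof -
  obtain a b where f: "dep_supp a" "dep_supp b" "f = (\<lambda>S. a S + rder G b S)"
    using assms(1) by (rule osrelE)
  show ?thesis
    by (rule osrelI[of "\<lambda>S. c * a S" "\<lambda>S. c * b S"])
       (use f in \<open>simp_all add: dep_supp_scale rder_scale distrib_left\<close>)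
qed

lemma osrel_diff: "f \<in> osrel \<Longrightarrow> g \<in> osrel \<Longrightarrow> (\<lambda>S. f S - g S) \<in> osrel"
  using osrel_add[of f "\<lambda>S. -1 * g S"] osrel_scale[of g "-1"] by simp

lemma osrel_sum:
  "(\<And>x. x \<in> A \<Longrightarrow> f x \<in> osrel) \<Longrightarrow> (\<lambda>S. \<Sum>x\<in>A. f x S) \<in> osrel"
  by (induction A rule: infinite_finite_induct) (auto simp: osrel_zero intro: osrel_add)

lemma osrel_support:
  assumes "f \<in> osrel" "f S \<noteq> 0"
  shows "S \<subseteq> G"
proof -
  obtain a b where f: "dep_supp a" "dep_supp b" "f = (\<lambda>S. a S + rder G b S)"
    using assms(1) by (rule osrelE)
  then consider "a S \<noteq> 0" | "rder G b S \<noteq> 0" using assms(2) by fastforce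
  then show ?thesis
  proof cases
    case 2
    then obtain i where "b (insert i S) \<noteq> 0" by (rule rder_nonzeroE)
    then show ?thesis using f(2) by (auto simp: dep_supp_def)
  qed (use f(1) in \<open>auto simp: dep_supp_def\<close>)
qed

text \<open>By the Clifford relation, \<open>rder G b\<close> times v is a multiple of b minus the
  derivative of b times v. The assumption on v keeps supports inside G.\<close>

lemma osrel_rmul:
  assumes "f \<in> osrel" and v: "\<And>i. v i \<noteq> 0 \<Longrightarrow> i \<in> G"
  shows "rmul v f \<in> osrel"
proof -
  obtain a b where f: "dep_supp a" "dep_supp b" "f = (\<lambda>S. a S + rder G b S)"
    using assms(1) by (rule osrelE)
  have "rmul v (rder G b) = (\<lambda>S. (\<Sum>i\<in>G. v i) * b S - rder G (rmul v b) S)"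
    using f(2) by (intro rmul_rder_fun finite_ground) (auto simp: dep_supp_def intro: finite_subG)
  then show ?thesis
    unfolding f(3) rmul_add
    by (auto intro!: osrel_add osrel_diff osrel_dep[OF dep_supp_rmul] osrel_scale osrel_dep[OF f(2)]
        osrel_rder[OF dep_supp_rmul] f v)
qed

lemma osrel_rder_ground:
  assumes "f \<in> osrel"
  shows "rder G f \<in> osrel"
proof -
  obtain a b where f: "dep_supp a" "dep_supp b" "f = (\<lambda>S. a S + rder G b S)"
    using assms(1) by (rule osrelE)
  have "rder G (rder G b) = (\<lambda>_. 0)"
  proof
    fix S
    show "rder G (rder G b) S = 0"
    proof (cases "S \<subseteq> G")
      case False
      have "rder G b (insert i S) = 0" for i
        using osrel_support[OF osrel_rder[OF f(2)], of "insert i S"] False by auto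
      then show ?thesis unfolding rder_def[of G "rder G b"] by simp
    qed (simp add: rder_rder finite_ground)
  qed
  then show ?thesis using osrel_rder[OF f(1)] by (simp add: f(3) rder_add)
qed

section \<open>Functionals vanishing on the relations\<close>

lemma osann_pairing:
  assumes \<phi>: "osann \<phi>" and "f \<in> osrel"
  shows "pairing G \<phi> f = 0"
proof -
  obtain a b where f: "dep_supp a" "dep_supp b" "f = (\<lambda>S. a S + rder G b S)"
    using assms(2) by (rule osrelE)
  have 1: "pairing G \<phi> a = 0"
    unfolding pairing_def using \<phi> f(1) by (intro sum.neutral) (auto simp: osann_def dep_supp_def)
  have 2: "pairing G (rmul (\<lambda>_. 1) \<phi>) b = 0"
    unfolding pairing_def using \<phi> f(2) by (intro sum.neutral) (auto simp: osann_def dep_supp_def)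
  have "pairing G \<phi> f = pairing G \<phi> a + pairing G \<phi> (rder G b)"
    by (simp add: f(3) pairing_def distrib_left sum.distrib)
  then show ?thesis using 1 2 by (simp add: pairing_rder finite_ground)
qed

lemma osann_sum:
  assumes "\<And>x. x \<in> A \<Longrightarrow> osann (f x)"
  shows "osann (\<lambda>S. \<Sum>x\<in>A. f x S)"
  using assms by (auto simp: osann_def rmul_sum intro!: sum.neutral)

lemma osann_scale: "osann f \<Longrightarrow> osann (\<lambda>S. c * f S)"
  by (auto simp: osann_def rmul_scale)

lemma osann_rmul_one: "osann \<phi> \<Longrightarrow> osann (rmul (\<lambda>_. 1) \<phi>)"
  by (auto simp: osann_def rmul_rmul_one)

text \<open>The annihilator can be truncated to a flat. A bad D would have D - {i} inside X with
  nonzero value, hence independent, and i outside X; then \<open>flat_augment\<close> makes D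
  independent.\<close>

lemma osann_cut:
  assumes X: "X \<in> flats G \<I>" and \<phi>: "osann \<phi>"
  shows "osann (\<lambda>S. if S \<subseteq> X then \<phi> S else 0)"
  unfolding osann_def
proof (intro allI impI conjI)
  fix D assume D: "D \<subseteq> G" "D \<notin> \<I>"
  then show "(if D \<subseteq> X then \<phi> D else 0) = 0" using \<phi> by (simp add: osann_def)
  let ?\<psi> = "\<lambda>S. if S \<subseteq> X then \<phi> S else 0"
  show "rmul (\<lambda>_. 1) ?\<psi> D = 0"
  proof (cases "D \<subseteq> X")
    case True
    then have "rmul (\<lambda>_. 1) ?\<psi> D = rmul (\<lambda>_. 1) \<phi> D"
      unfolding rmul_def by (intro sum.cong) auto
    then show ?thesis using \<phi> D by (simp add: osann_def)
  next
    case False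
    show ?thesis
    proof (rule ccontr)
      assume "rmul (\<lambda>_. 1) ?\<psi> D \<noteq> 0"
      then obtain i where i: "i \<in> D" "?\<psi> (D - {i}) \<noteq> 0" by (rule rmul_nonzeroE)
      then have sub: "D - {i} \<subseteq> X" and "\<phi> (D - {i}) \<noteq> 0" by (auto split: if_splits)
      then have "D - {i} \<in> \<I>" using \<phi> D unfolding osann_def by blast
      moreover have "i \<in> G - X" using sub False D i by auto
      ultimately have "insert i (D - {i}) \<in> \<I>" using flat_augment[OF X _ sub] by blast
      moreover have "insert i (D - {i}) = D" using i by auto
      ultimately show False using D by simp
    qed
  qed
qed

text \<open>Split f according to whether S - Y is independent. If it is dependent, removing a point
  of Y leaves a dependent set. If it is independent, every circuit in S meets Y and so lies in Y;
  then removing a point outside Y leaves a dependent set, and \<open>rder Y\<close> is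
  \<open>rder G\<close> minus \<open>rder (G - Y)\<close>.\<close>

lemma rder_component:
  assumes f: "dep_supp f" "\<And>S. f S \<noteq> 0 \<Longrightarrow> S \<subseteq> X" and YG: "Y \<subseteq> G"
    and sep: "\<And>C. C \<in> circuits G \<I> \<Longrightarrow> C \<subseteq> X \<Longrightarrow> C \<inter> Y \<noteq> {} \<Longrightarrow> C \<subseteq> Y"
  shows "rder Y f \<in> osrel"
proof -
  define f1 where "f1 S = (if S - Y \<in> \<I> then f S else 0)" for S
  define f2 where "f2 S = (if S - Y \<in> \<I> then 0 else f S)" for S
  have f12: "f = (\<lambda>S. f1 S + f2 S)" by (auto simp: f1_def f2_def)
  have 2: "dep_supp (rder Y f2)"
    unfolding dep_supp_def
  proof (intro allI impI)
    fix S assume "rder Y f2 S \<noteq> 0"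
    then obtain i where i: "i \<in> Y - S" "f2 (insert i S) \<noteq> 0" by (rule rder_nonzeroE)
    then have "S \<subseteq> G" "insert i S - Y \<notin> \<I>" using f(1) by (auto simp: f2_def dep_supp_def split: if_splits)
    moreover have "insert i S - Y \<subseteq> S" using i by auto
    ultimately show "S \<subseteq> G \<and> S \<notin> \<I>" using indep_mono by blast
  qed
  have 1: "dep_supp (rder (G - Y) f1)"
    unfolding dep_supp_def
  proof (intro allI impI)
    fix S assume "rder (G - Y) f1 S \<noteq> 0"
    then obtain i where i: "i \<in> (G - Y) - S" "f1 (insert i S) \<noteq> 0" by (rule rder_nonzeroE)
    then have iS: "insert i S \<subseteq> G" "insert i S \<notin> \<I>" "insert i S \<subseteq> X" "insert i S - Y \<in> \<I>"
      using f by (auto simp: f1_def dep_supp_def split: if_splits)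
    obtain C where C: "C \<in> circuits G \<I>" "C \<subseteq> insert i S"
      using circuit_exists iS by blast
    have "C \<inter> Y \<noteq> {}" using indep_mono[OF iS(4), of C] C circuitD(2) by auto
    then have "C \<subseteq> Y" using sep C iS by blast
    then have "C \<subseteq> S" using C i by auto
    then show "S \<subseteq> G \<and> S \<notin> \<I>" using iS C circuitD(2) indep_mono by blast
  qed
  have 3: "rder Y f1 = (\<lambda>S. rder G f1 S - rder (G - Y) f1 S)"
  proof
    fix S
    have "rder G f1 S = rder Y f1 S + rder (G - Y) f1 S"
    proof -
      have e: "G - S = (Y - S) \<union> (G - Y - S)" using YG by auto
      show ?thesis
        unfolding rder_def e using finite_ground YG
        by (intro sum.union_disjoint) (auto intro: finite_subG)
    qed
    then show "rder Y f1 S = rder G f1 S - rder (G - Y) f1 S" by simp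
  qed
  have "dep_supp f1" using f(1) by (auto simp: f1_def dep_supp_def)
  then have "rder Y f1 \<in> osrel" unfolding 3 by (intro osrel_diff osrel_rder osrel_dep 1)
  then show ?thesis unfolding f12 rder_add by (intro osrel_add osrel_dep[OF 2])
qed

section \<open>Surjectivity and injectivity of the contravariant form in low degrees\<close>

text \<open>The support clause strengthens the induction: on functionals supported in the closure X
  of T, multiplication by the part of v on X is multiplication by v followed by truncation to
  X.\<close>

lemma basis_representation:
  fixes v :: "'a \<Rightarrow> 'k::field"
  assumes noloop: "\<And>y. y \<in> G \<Longrightarrow> {y} \<in> \<I>"
    and nonres: "\<And>X. X \<in> irr_flats_le G \<I> m \<Longrightarrow> (\<Sum>i\<in>X. v i) \<noteq> 0"
    and T: "T \<in> \<I>" "card T \<le> m"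
  shows "\<exists>\<phi>. osann \<phi> \<and> (\<forall>S. \<phi> S \<noteq> 0 \<longrightarrow> S \<subseteq> mcl T \<and> card S = card T) \<and>
    (\<lambda>S. ext_basis T S - diag v \<phi> S) \<in> osrel"
  using T
proof (induction "card T" arbitrary: T)
  case 0
  then have T: "T = {}" using indep_finite by auto
  \<comment> \<open>Multiplying the unit by u gives values on singletons only, and these are
    independent.\<close>
  have "osann (ext_basis {} :: 'a set \<Rightarrow> 'k)"
    unfolding osann_def
  proof (intro allI impI conjI)
    fix D assume D: "D \<subseteq> G" "D \<notin> \<I>"
    then show "ext_basis {} D = (0 :: 'k)" using indep_empty by (auto simp: ext_basis_def)
    show "rmul (\<lambda>_. 1) (ext_basis {}) D = (0 :: 'k)"
    proof (rule ccontr)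
      assume "rmul (\<lambda>_. 1) (ext_basis {}) D \<noteq> (0 :: 'k)"
      then obtain i where "i \<in> D" "ext_basis {} (D - {i}) \<noteq> (0 :: 'k)" by (rule rmul_nonzeroE)
      then have "D = {i}" by (auto simp: ext_basis_def split: if_splits)
      then show False using D noloop by auto
    qed
  qed
  moreover have "diag v (ext_basis {}) = ext_basis {}"
    by (auto simp: diag_def ext_basis_def)
  ultimately show ?case
    using osrel_zero by (intro exI[of _ "ext_basis {}"]) (auto simp: T ext_basis_def split: if_splits)
next
  case (Suc q)
  note finT = indep_finite[OF Suc.prems(1)]
  define X where "X = mcl T"
  have X: "X \<in> flats G \<I>" "mrank \<I> X = Suc q" "T \<subseteq> X" "X \<subseteq> G"
    using mcl_flat mrank_mcl mcl_superset Suc.prems Suc.hyps(2) by (auto simp: X_def mcl_def)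
  obtain x where "x \<in> T" using Suc.hyps(2) by fastforce
  then obtain Y where Y: "Y \<subseteq> X" "Y \<in> irr_flats_le G \<I> (mrank \<I> X)"
    and sep: "\<And>C. C \<in> circuits G \<I> \<Longrightarrow> C \<subseteq> X \<Longrightarrow> C \<inter> Y \<noteq> {} \<Longrightarrow> C \<subseteq> Y"
    using component_exists[OF X(1) noloop, of x] X(3) by blast
  have YG: "Y \<subseteq> G" and finY: "finite Y" using Y X finite_subG by auto
  define c where "c = (\<Sum>i\<in>Y. v i)"
  have "Y \<in> irr_flats_le G \<I> m" using Y X(2) Suc.prems(2) Suc.hyps(2) by (auto simp: irr_flats_le_def)
  then have c: "c \<noteq> 0" unfolding c_def by (rule nonres)
  \<comment> \<open>The part of v on X. Its product f with \<open>ext_basis T\<close> is zero modulo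
    the relations, since adding to T a further element of its closure makes it dependent.\<close>
  define w where "w i = (if i \<in> X then v i else 0)" for i
  have w: "i \<in> X" if "w i \<noteq> 0" for i using that by (auto simp: w_def split: if_splits)
  have cw: "(\<Sum>i\<in>Y. w i) = c" unfolding c_def using Y by (intro sum.cong) (auto simp: w_def)
  define f where "f = rmul w (ext_basis T)"
  have f: "S \<subseteq> X \<and> S \<notin> \<I>" if nz: "f S \<noteq> 0" for S
  proof -
    obtain i where i: "i \<in> S" "w i \<noteq> 0" "ext_basis T (S - {i}) \<noteq> (0 :: 'k)"
      using nz unfolding f_def by (rule rmul_nonzeroE)
    then have S: "S - {i} = T" by (auto simp: ext_basis_def split: if_splits)
    then have "S = insert i T" "i \<notin> T" using i by auto
    then show ?thesis using X w[OF i(2)] by (auto simp: X_def mcl_def)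
  qed
  have fY: "rder Y f \<in> osrel"
  proof (rule rder_component[OF _ _ YG])
    show "dep_supp f" using f X(4) unfolding dep_supp_def by blast
    show "S \<subseteq> X" if "f S \<noteq> 0" for S using f[OF that] by blast
  qed (rule sep)
  have "\<forall>j\<in>Y \<inter> T. \<exists>\<phi>. osann \<phi> \<and> (\<forall>S. \<phi> S \<noteq> 0 \<longrightarrow> S \<subseteq> mcl (T - {j}) \<and> card S = card (T - {j})) \<and>
      (\<lambda>S. ext_basis (T - {j}) S - diag v \<phi> S) \<in> osrel"
  proof
    fix j assume j: "j \<in> Y \<inter> T"
    then have q: "q = card (T - {j})" using Suc.hyps(2) finT by auto
    show "\<exists>\<phi>. osann \<phi> \<and> (\<forall>S. \<phi> S \<noteq> 0 \<longrightarrow> S \<subseteq> mcl (T - {j}) \<and> card S = card (T - {j})) \<and>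
      (\<lambda>S. ext_basis (T - {j}) S - diag v \<phi> S) \<in> osrel"
    proof (rule Suc.hyps(1)[OF q])
      show "card (T - {j}) \<le> m" using q Suc.prems(2) Suc.hyps(2) by linarith
      show "T - {j} \<in> \<I>" using indep_mono[OF Suc.prems(1)] by auto
    qed
  qed
  from bchoice[OF this] obtain \<Phi> where \<Phi>: "\<And>j. j \<in> Y \<inter> T \<Longrightarrow> osann (\<Phi> j)"
    "\<And>j S. j \<in> Y \<inter> T \<Longrightarrow> \<Phi> j S \<noteq> 0 \<Longrightarrow> S \<subseteq> mcl (T - {j}) \<and> card S = card (T - {j})"
    "\<And>j. j \<in> Y \<inter> T \<Longrightarrow> (\<lambda>S. ext_basis (T - {j}) S - diag v (\<Phi> j) S) \<in> osrel"
    by blast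
  \<comment> \<open>Combines the induction hypotheses for the sets T - {j} into a representation of
    \<open>rder Y (ext_basis T)\<close>, one degree below T.\<close>
  define \<phi> where "\<phi> S = (\<Sum>j\<in>Y \<inter> T. ext_sign (T - {j}) {j} * \<Phi> j S)" for S
  have \<phi>: "osann \<phi>" unfolding \<phi>_def by (intro osann_sum osann_scale \<Phi>)
  have \<phi>_supp: "S \<subseteq> X \<and> card S = q" if nz: "\<phi> S \<noteq> 0" for S
  proof -
    obtain j where j: "j \<in> Y \<inter> T" "\<Phi> j S \<noteq> 0"
      using nz unfolding \<phi>_def by (metis (no_types, lifting) mult_zero_right sum.neutral)
    have "mcl (T - {j}) \<subseteq> X" unfolding X_def by (intro mcl_mono) auto
    then show ?thesis using \<Phi>(2)[OF j] Suc.hyps(2) j finT by auto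
  qed
  define h where "h = rder Y (ext_basis T :: 'a set \<Rightarrow> 'k)"
  have "(\<lambda>S. h S - diag v \<phi> S) = (\<lambda>S. \<Sum>j\<in>Y \<inter> T. ext_sign (T - {j}) {j} *
      (ext_basis (T - {j}) S - diag v (\<Phi> j) S))"
    unfolding h_def rder_basis[OF finY] \<phi>_def diag_sum diag_scale
    by (simp add: right_diff_distrib sum_subtractf)
  also have "\<dots> \<in> osrel" by (intro osrel_sum osrel_scale \<Phi>)
  finally have "rmul w (\<lambda>S. h S - diag v \<phi> S) \<in> osrel"
    using X w by (intro osrel_rmul) auto
  then have hw: "(\<lambda>S. rmul w h S - rmul w (diag v \<phi>) S) \<in> osrel" by (simp add: rmul_diff)
  \<comment> \<open>Multiplying \<phi> by u restores the degree of T; truncation restores the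
    support in X and stays in the annihilator by \<open>osann_cut\<close>.\<close>
  define \<psi> where "\<psi> S = (if S \<subseteq> X then rmul (\<lambda>_. 1) \<phi> S else 0)" for S
  have \<psi>: "osann \<psi>" unfolding \<psi>_def by (intro osann_cut X osann_rmul_one \<phi>)
  have \<psi>_supp: "S \<subseteq> X \<and> card S = Suc q" if "\<psi> S \<noteq> 0" for S
  proof -
    have "S \<subseteq> X" "rmul (\<lambda>_. 1) \<phi> S \<noteq> 0" using that by (auto simp: \<psi>_def split: if_splits)
    moreover from this(2) obtain i where "i \<in> S" "finite S" "\<phi> (S - {i}) \<noteq> 0"
      by (rule rmul_nonzeroE)
    then have "card S = Suc q" using \<phi>_supp card_Suc_Diff1 by metis
    ultimately show ?thesis by simp
  qed
  have mul: "rmul w (diag v \<phi>) = diag v \<psi>"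
  proof
    fix S
    show "rmul w (diag v \<phi>) S = diag v \<psi> S"
    proof (cases "S \<subseteq> X")
      case True
      then have "rmul w (diag v \<phi>) S = rmul v (diag v \<phi>) S"
        unfolding rmul_def by (intro sum.cong) (auto simp: w_def)
      then show ?thesis using True by (simp add: rmul_diag) (simp add: diag_def \<psi>_def)
    next
      case False
      have "rmul w (diag v \<phi>) S = 0"
      proof (rule ccontr)
        assume "rmul w (diag v \<phi>) S \<noteq> 0"
        then obtain i where "i \<in> S" "w i \<noteq> 0" "diag v \<phi> (S - {i}) \<noteq> 0" by (rule rmul_nonzeroE)
        then show False using False w \<phi>_supp[of "S - {i}"] by (auto simp: diag_def)
      qed
      then show ?thesis using False by (simp add: diag_def \<psi>_def)
    qed
  qed
  \<comment> \<open>The Clifford relation for Y and w: the first term is a relation, the second is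
    represented by \<psi>, and c is invertible because Y is nonresonant.\<close>
  have "(\<lambda>S. rder Y f S + rmul w h S) = (\<lambda>S. c * ext_basis T S)"
    unfolding f_def h_def
    unfolding cw[symmetric] using finT
    by (intro rder_rmul_fun finY) (simp add: ext_basis_def split: if_splits)
  moreover have "(\<lambda>S. (rder Y f S + rmul w h S) - diag v \<psi> S) \<in> osrel"
    using osrel_add[OF fY hw] by (simp add: mul add_diff_eq)
  ultimately have "(\<lambda>S. c * ext_basis T S - diag v \<psi> S) \<in> osrel"
    by (simp only: fun_eq_iff)
  then have "(\<lambda>S. inverse c * (c * ext_basis T S - diag v \<psi> S)) \<in> osrel" by (rule osrel_scale)
  then have "(\<lambda>S. ext_basis T S - diag v (\<lambda>S. inverse c * \<psi> S) S) \<in> osrel"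
    using c by (simp add: diag_scale right_diff_distrib flip: mult.assoc)
  moreover have "osann (\<lambda>S. inverse c * \<psi> S)" by (intro osann_scale \<psi>)
  ultimately show ?case
    using \<psi>_supp Suc.hyps(2) unfolding X_def
    by (intro exI[of _ "\<lambda>S. inverse c * \<psi> S"]) auto
qed

lemma representation:
  fixes v :: "'a \<Rightarrow> 'k::field"
  assumes noloop: "\<And>y. y \<in> G \<Longrightarrow> {y} \<in> \<I>"
    and nonres: "\<And>X. X \<in> irr_flats_le G \<I> m \<Longrightarrow> (\<Sum>i\<in>X. v i) \<noteq> 0"
    and x: "x \<in> ext_deg G p" and p: "p \<le> m"
  obtains \<phi> where "osann \<phi>" "\<And>S. \<phi> S \<noteq> 0 \<Longrightarrow> S \<subseteq> G \<and> card S = p"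
    "(\<lambda>S. x S - diag v \<phi> S) \<in> osrel"
proof -
  define B where "B = {T \<in> \<I>. card T = p}"
  have "\<forall>T\<in>B. \<exists>\<phi>. osann \<phi> \<and> (\<forall>S. \<phi> S \<noteq> 0 \<longrightarrow> S \<subseteq> mcl T \<and> card S = card T) \<and>
      (\<lambda>S. ext_basis T S - diag v \<phi> S) \<in> osrel"
    using p by (intro ballI basis_representation[OF noloop nonres]) (auto simp: B_def)
  from bchoice[OF this] obtain \<Phi> where \<Phi>: "\<And>T. T \<in> B \<Longrightarrow> osann (\<Phi> T)"
    "\<And>T S. T \<in> B \<Longrightarrow> \<Phi> T S \<noteq> 0 \<Longrightarrow> S \<subseteq> mcl T \<and> card S = card T"
    "\<And>T. T \<in> B \<Longrightarrow> (\<lambda>S. ext_basis T S - diag v (\<Phi> T) S) \<in> osrel"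
    by blast
  define \<phi> where "\<phi> S = (\<Sum>T\<in>B. x T * \<Phi> T S)" for S
  have finB: "finite B" using finite_indeps by (auto simp: B_def)
  have 1: "osann \<phi>" unfolding \<phi>_def by (intro osann_sum osann_scale \<Phi>)
  have 2: "S \<subseteq> G \<and> card S = p" if nz: "\<phi> S \<noteq> 0" for S
  proof -
    obtain T where T: "T \<in> B" "\<Phi> T S \<noteq> 0"
      using nz unfolding \<phi>_def by (metis (no_types, lifting) mult_zero_right sum.neutral)
    then show ?thesis using \<Phi>(2)[OF T] by (auto simp: B_def mcl_def)
  qed
  \<comment> \<open>The dependent part of x, which is a relation; the rest is a combination of
    independent basis elements.\<close>
  define d where "d S = (if S \<in> \<I> then 0 else x S)" for S
  have d: "dep_supp d" using x by (auto simp: dep_supp_def d_def ext_deg_def)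
  have xd: "x S = (\<Sum>T\<in>B. x T * ext_basis T S) + d S" for S
  proof -
    have "(\<Sum>T\<in>B. x T * ext_basis T S) = (if S \<in> B then x S else 0)"
      using finB by (simp add: ext_basis_def if_distrib cong: if_cong)
    then show ?thesis using x by (auto simp: d_def B_def ext_deg_def)
  qed
  have "(\<lambda>S. x S - diag v \<phi> S) =
      (\<lambda>S. (\<Sum>T\<in>B. x T * (ext_basis T S - diag v (\<Phi> T) S)) + d S)"
    unfolding \<phi>_def diag_sum diag_scale
    by (subst (1) xd) (simp add: right_diff_distrib sum_subtractf diff_add_eq)
  also have "\<dots> \<in> osrel" by (intro osrel_add osrel_sum osrel_scale \<Phi> osrel_dep d)
  finally show thesis using that 1 2 by blast
qed

text \<open>Represent \<open>ext_basis S\<close> by some \<chi>. Then the value of \<phi> at S is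
  the form on \<phi> and \<chi>, which by symmetry pairs \<chi> with the relation
  \<open>diag v \<phi>\<close> and is zero.\<close>

lemma osann_diag_inj:
  fixes v :: "'a \<Rightarrow> 'k::field"
  assumes noloop: "\<And>y. y \<in> G \<Longrightarrow> {y} \<in> \<I>"
    and nonres: "\<And>X. X \<in> irr_flats_le G \<I> m \<Longrightarrow> (\<Sum>i\<in>X. v i) \<noteq> 0"
    and \<phi>: "osann \<phi>" "diag v \<phi> \<in> osrel" and S: "S \<subseteq> G" "card S \<le> m"
  shows "\<phi> S = 0"
proof -
  have "(ext_basis S :: 'a set \<Rightarrow> 'k) \<in> ext_deg G (card S)"
    using S by (auto simp: ext_deg_def ext_basis_def)
  from representation[OF noloop nonres this S(2)] obtain \<chi>
    where \<chi>: "osann \<chi>" "(\<lambda>T. ext_basis S T - diag v \<chi> T) \<in> osrel" by blast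
  have "pairing G \<phi> (\<lambda>T. ext_basis S T - diag v \<chi> T) = 0" by (rule osann_pairing[OF \<phi>(1) \<chi>(2)])
  then have "pairing G \<phi> (ext_basis S) = pairing G \<phi> (diag v \<chi>)"
    by (simp add: pairing_def right_diff_distrib sum_subtractf)
  also have "\<dots> = 0" unfolding pairing_diag[of G \<phi>] by (rule osann_pairing[OF \<chi>(1) \<phi>(2)])
  finally show ?thesis using S by (simp add: pairing_basis finite_ground)
qed

text \<open>The rank bound is p + 1 because injectivity is applied to the product of \<phi> with u,
  which has degree p + 1. For p = 0 the condition with \<open>Suc\<close> forces y = 0.\<close>

lemma exact_nonresonant:
  fixes v :: "'a \<Rightarrow> 'k::field"
  assumes noloop: "\<And>y. y \<in> G \<Longrightarrow> {y} \<in> \<I>" and g: "g \<in> G"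
    and nonres: "\<And>X. X \<in> irr_flats_le G \<I> (p + 1) \<Longrightarrow> (\<Sum>i\<in>X. v i) \<noteq> 0"
    and v: "\<And>i. v i \<noteq> 0 \<Longrightarrow> i \<in> G"
    and x: "x \<in> ext_deg G p" "rmul v x \<in> osrel"
  obtains y where "\<And>S. y S \<noteq> 0 \<Longrightarrow> S \<subseteq> G \<and> Suc (card S) = p"
    "(\<lambda>S. x S - rmul v y S) \<in> osrel"
proof -
  obtain \<phi> where \<phi>: "osann \<phi>" "\<And>S. \<phi> S \<noteq> 0 \<Longrightarrow> S \<subseteq> G \<and> card S = p"
    "(\<lambda>S. x S - diag v \<phi> S) \<in> osrel"
    using representation[OF noloop nonres x(1), of "p + 1"] by auto
  have "rmul v (\<lambda>S. x S - diag v \<phi> S) \<in> osrel" by (rule osrel_rmul[OF \<phi>(3) v])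
  from osrel_diff[OF x(2) this] have D: "diag v (rmul (\<lambda>_. 1) \<phi>) \<in> osrel"
    by (simp add: rmul_diff rmul_diag)
  have cocycle: "rmul (\<lambda>_. 1) \<phi> S = 0" if S: "S \<subseteq> G" for S
  proof (rule ccontr)
    assume nz: "rmul (\<lambda>_. 1) \<phi> S \<noteq> 0"
    then obtain i where "i \<in> S" "finite S" "\<phi> (S - {i}) \<noteq> 0" by (rule rmul_nonzeroE)
    then have "card S = p + 1" using \<phi>(2) card_Suc_Diff1 by (metis Suc_eq_plus1)
    then show False
      using nz osann_diag_inj[OF noloop nonres osann_rmul_one[OF \<phi>(1)] D S] by simp
  qed
  \<comment> \<open>Since u has coefficient 1 at g, contraction by g is a contracting homotopy for
    multiplication by u.\<close>
  define \<psi> where "\<psi> = rder {g} \<phi>"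
  have \<psi>: "S \<subseteq> G \<and> Suc (card S) = p" if "\<psi> S \<noteq> 0" for S
  proof -
    have "g \<notin> S" "\<phi> (insert g S) \<noteq> 0"
      using that unfolding \<psi>_def by (auto elim: rder_nonzeroE)
    then show ?thesis using \<phi>(2)[of "insert g S"] finite_subG[of S] by auto
  qed
  have "diag v \<phi> = rmul v (diag v \<psi>)"
  proof
    fix S
    show "diag v \<phi> S = rmul v (diag v \<psi>) S"
    proof (cases "S \<subseteq> G")
      case True
      have "rder {g} (rmul (\<lambda>_. 1) \<phi>) S = 0"
        unfolding rder_def using cocycle True g by (intro sum.neutral) auto
      then have "rmul (\<lambda>_. 1) \<psi> S = \<phi> S"
        using rder_rmul[of "{g}" S "\<lambda>_. 1" \<phi>] finite_subG[OF True] by (simp add: \<psi>_def)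
      then show ?thesis unfolding rmul_diag by (simp add: diag_def)
    next
      case False
      have "rmul v (diag v \<psi>) S = 0"
      proof (rule ccontr)
        assume "rmul v (diag v \<psi>) S \<noteq> 0"
        then obtain i where "i \<in> S" "v i \<noteq> 0" "diag v \<psi> (S - {i}) \<noteq> 0" by (rule rmul_nonzeroE)
        then show False using False v \<psi>[of "S - {i}"] by (auto simp: diag_def)
      qed
      then show ?thesis using False \<phi>(2)[of S] by (auto simp: diag_def)
    qed
  qed
  then have "(\<lambda>S. x S - rmul v (diag v \<psi>) S) \<in> osrel" using \<phi>(3) by simp
  moreover have "S \<subseteq> G \<and> Suc (card S) = p" if "diag v \<psi> S \<noteq> 0" for S
    using that \<psi> by (simp add: diag_def)
  ultimately show thesis using that by blast
qed

end

section \<open>The Orlik--Solomon ideal and its cohomology\<close>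

lemma carrier_ext_alg: "f \<in> carrier (ext_alg G) \<longleftrightarrow> (\<forall>S. f S \<noteq> 0 \<longrightarrow> S \<subseteq> G)"
  by (simp add: ext_alg_def)

lemma ext_basis_carrier: "T \<subseteq> G \<Longrightarrow> ext_basis T \<in> carrier (ext_alg G)"
  by (simp add: carrier_ext_alg ext_basis_def)

lemma ext_mult_carrier:
  "f \<in> carrier (ext_alg G) \<Longrightarrow> g \<in> carrier (ext_alg G) \<Longrightarrow> ext_mult f g \<in> carrier (ext_alg G)"
  unfolding carrier_ext_alg using ext_mult_support[of f G g] by blast

lemma ext_der_carrier:
  assumes "f \<in> carrier (ext_alg G)"
  shows "ext_der G f \<in> carrier (ext_alg G)"
  unfolding carrier_ext_alg
proof (intro allI impI)
  fix S assume "ext_der G f S \<noteq> 0"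
  then obtain i where "f (insert i S) \<noteq> 0"
    unfolding ext_der_def by (metis (no_types, lifting) mult_zero_right sum.neutral)
  then show "S \<subseteq> G" using assms unfolding carrier_ext_alg by blast
qed

lemma ext_mult_sum_left: "ext_mult (\<lambda>S. \<Sum>x\<in>A. f x S) g = (\<lambda>S. \<Sum>x\<in>A. ext_mult (f x) g S)"
  unfolding ext_mult_def
  by (rule ext, subst sum.swap) (simp add: sum_distrib_left sum_distrib_right)

lemma ext_mult_scale_left: "ext_mult (\<lambda>S. c * f S) g = (\<lambda>S. c * ext_mult f g S)"
  by (simp add: ext_mult_def sum_distrib_left mult_ac)

lemma ext_mult_add_right: "ext_mult f (\<lambda>S. g S + h S) = (\<lambda>S. ext_mult f g S + ext_mult f h S)"
  by (simp add: ext_mult_def distrib_left sum.distrib)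

lemma ext_mult_add_left: "ext_mult (\<lambda>S. g S + h S) f = (\<lambda>S. ext_mult g f S + ext_mult h f S)"
  by (simp add: ext_mult_def distrib_left distrib_right sum.distrib)

lemma ext_der_sum: "ext_der G (\<lambda>S. \<Sum>x\<in>A. f x S) = (\<lambda>S. \<Sum>x\<in>A. ext_der G (f x) S)"
  unfolding ext_der_def by (rule ext, subst sum.swap) (simp add: sum_distrib_left)

lemma ext_der_scale: "ext_der G (\<lambda>S. c * f S) = (\<lambda>S. c * ext_der G f S)"
  by (simp add: ext_der_def sum_distrib_left mult_ac)

lemma ext_alg_simps [simp]:
  "f \<oplus>\<^bsub>ext_alg G\<^esub> g = (\<lambda>S. f S + g S)" "f \<otimes>\<^bsub>ext_alg G\<^esub> g = ext_mult f g"
  "\<zero>\<^bsub>ext_alg G\<^esub> = (\<lambda>_. 0)" "\<one>\<^bsub>ext_alg G\<^esub> = ext_basis {}"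
  by (simp_all add: ext_alg_def)

lemma ext_alg_uminus:
  assumes "finite G" "f \<in> carrier (ext_alg G)"
  shows "\<ominus>\<^bsub>ext_alg G\<^esub> f = (\<lambda>S. - f S :: 'k::field)"
proof -
  interpret ring "ext_alg G :: ('a set \<Rightarrow> 'k) ring" by (rule ring_ext_alg[OF assms(1)])
  show ?thesis
    by (rule minus_equality) (use assms(2) in \<open>auto simp: carrier_ext_alg\<close>)
qed

lemma ext_alg_minus:
  assumes "finite G" "g \<in> carrier (ext_alg G)"
  shows "f \<ominus>\<^bsub>ext_alg G\<^esub> g = (\<lambda>S. f S - g S :: 'k::field)"
  by (simp add: a_minus_def ext_alg_uminus[OF assms])

section \<open>The Leibniz rule for inhomogeneous elements\<close>

text \<open>The degree involution; it absorbs the degree-dependent sign of the Leibniz rule when f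
  is not homogeneous.\<close>

definition grade_inv :: "('a set \<Rightarrow> 'k::field) \<Rightarrow> 'a set \<Rightarrow> 'k" where
  "grade_inv f = (\<lambda>S. (- 1) ^ card S * f S)"

lemma minus_one_power_sq: "(- 1) ^ n * ((- 1) ^ n * x) = (x :: 'k::field)"
  by (simp flip: mult.assoc power_mult_distrib)

lemma grade_inv_grade_inv [simp]: "grade_inv (grade_inv f) = f"
  by (simp add: grade_inv_def minus_one_power_sq)

lemma grade_inv_carrier: "f \<in> carrier (ext_alg G) \<Longrightarrow> grade_inv f \<in> carrier (ext_alg G)"
  by (simp add: carrier_ext_alg grade_inv_def)

lemma ext_der_mult:
  fixes f g :: "'a::linorder set \<Rightarrow> 'k::field"
  assumes G: "finite G" and f: "f \<in> carrier (ext_alg G)" and g: "g \<in> carrier (ext_alg G)"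
  shows "ext_der G (ext_mult f g) =
    (\<lambda>S. ext_mult (ext_der G f) g S + ext_mult (grade_inv f) (ext_der G g) S)"
proof
  fix S
  show "ext_der G (ext_mult f g) S =
    ext_mult (ext_der G f) g S + ext_mult (grade_inv f) (ext_der G g) S"
  proof (cases "S \<subseteq> G")
    case False
    have "h S = 0" if "h \<in> carrier (ext_alg G)" for h :: "'a set \<Rightarrow> 'k"
      using that False unfolding carrier_ext_alg by blast
    from this[OF ext_der_carrier[OF ext_mult_carrier[OF f g]]]
      this[OF ext_mult_carrier[OF ext_der_carrier[OF f] g]]
      this[OF ext_mult_carrier[OF grade_inv_carrier[OF f] ext_der_carrier[OF g]]]
    show ?thesis by simp
  next
    case True
    \<comment> \<open>The homogeneous component of degree p, to which \<open>ext_der_leibniz\<close>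
      applies.\<close>
    define H where "H p S = (if card S = p then f S else 0)" for p S
    let ?N = "{..card G}"
    have supp: "card T \<in> ?N" if "f T \<noteq> 0" for T
      using that f G by (auto simp: carrier_ext_alg intro: card_mono)
    have fH: "f = (\<lambda>S. \<Sum>p\<in>?N. H p S)"
      using supp by (force simp: H_def)
    have gH: "grade_inv f = (\<lambda>S. \<Sum>p\<in>?N. (- 1) ^ p * H p S)"
    proof
      fix T
      have "(\<Sum>p\<in>?N. (- 1) ^ p * H p T) = (\<Sum>p\<in>?N. if card T = p then (- 1) ^ card T * f T else 0)"
        by (intro sum.cong) (auto simp: H_def)
      then show "grade_inv f T = (\<Sum>p\<in>?N. (- 1) ^ p * H p T)"
        using supp[of T] by (auto simp: grade_inv_def)
    qed
    have "H p \<in> ext_deg G p" for p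
      using f by (auto simp: ext_deg_def H_def carrier_ext_alg)
    then have "ext_der G (ext_mult (H p) g) S =
        ext_mult (ext_der G (H p)) g S + (- 1) ^ p * ext_mult (H p) (ext_der G g) S" for p
      using ext_der_leibniz[OF G _ True] by blast
    then show ?thesis
      by (subst (1 2) fH) (simp add: gH ext_mult_sum_left ext_der_sum sum.distrib ext_mult_scale_left)
  qed
qed

context ordered_matroid begin

section \<open>Identification of the ideal\<close>

lemma dep_supp_carrier: "dep_supp f \<Longrightarrow> f \<in> carrier (ext_alg G)"
  by (simp add: dep_supp_def carrier_ext_alg)

lemma dep_supp_grade_inv: "dep_supp f \<Longrightarrow> dep_supp (grade_inv f)"
  by (simp add: dep_supp_def grade_inv_def)

lemma osrel_carrier: "f \<in> osrel \<Longrightarrow> f \<in> carrier (ext_alg G)"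
  unfolding carrier_ext_alg using osrel_support by blast

text \<open>The sign in \<open>rder_eq_ext_der\<close> counts the degree after contraction, whereas
  \<open>grade_inv\<close> counts the degree before it; the shift by one accounts for the factor
  -1.\<close>

lemma rder_ext_der:
  assumes b: "b \<in> carrier (ext_alg G)"
  shows "rder G b = ext_der G (\<lambda>S. - 1 * grade_inv b S)"
proof
  fix S
  show "rder G b S = ext_der G (\<lambda>S. - 1 * grade_inv b S) S"
  proof (cases "finite S")
    case True
    then show ?thesis
      unfolding rder_eq_ext_der[OF finite_ground True] unfolding ext_der_def sum_distrib_left
      by (intro sum.cong) (auto simp: grade_inv_def)
  next
    case False
    then have "b (insert i S) = 0" for i
      using b finite_subG[of "insert i S"] by (auto simp: carrier_ext_alg)
    then show ?thesis by (simp add: rder_def ext_der_def grade_inv_def)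
  qed
qed

lemma osrel_ext_der:
  assumes b: "dep_supp b"
  shows "ext_der G b \<in> osrel"
proof -
  have d: "dep_supp (\<lambda>S. - 1 * grade_inv b S)"
    by (intro dep_supp_scale dep_supp_grade_inv b)
  have "grade_inv (\<lambda>S. - 1 * grade_inv b S) = (\<lambda>S. - 1 * b S)"
    by (simp add: grade_inv_def minus_one_power_sq)
  then have "rder G (\<lambda>S. - 1 * grade_inv b S) = ext_der G b"
    unfolding rder_ext_der[OF dep_supp_carrier[OF d]] by simp
  then show ?thesis using osrel_rder[OF d] by simp
qed

lemma osrel_ext_derE:
  assumes "f \<in> osrel"
  obtains a b where "dep_supp a" "dep_supp b" "f = (\<lambda>S. a S + ext_der G b S)"
proof -
  obtain a b where f: "dep_supp a" "dep_supp b" "f = (\<lambda>S. a S + rder G b S)"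
    using assms by (rule osrelE)
  show thesis
    by (rule that[OF f(1) dep_supp_scale[OF dep_supp_grade_inv[OF f(2)]]])
       (simp only: f(3) rder_ext_der[OF dep_supp_carrier[OF f(2)]])
qed

lemma dep_supp_mult:
  assumes "dep_supp f" "h \<in> carrier (ext_alg G)"
  shows "dep_supp (ext_mult h f)" "dep_supp (ext_mult f h)"
proof -
  have "S \<subseteq> G \<and> S \<notin> \<I>" if "ext_mult h f S \<noteq> 0 \<or> ext_mult f h S \<noteq> 0" for S
  proof -
    have "\<exists>T\<in>Pow S. (h T \<noteq> 0 \<and> f (S - T) \<noteq> 0) \<or> (f T \<noteq> 0 \<and> h (S - T) \<noteq> 0)"
      using that unfolding ext_mult_def by (fastforce elim: sum.not_neutral_contains_not_neutral)
    then obtain T where T: "T \<subseteq> S"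
      "(h T \<noteq> 0 \<and> f (S - T) \<noteq> 0) \<or> (f T \<noteq> 0 \<and> h (S - T) \<noteq> 0)" by blast
    then have "T \<subseteq> G" "S - T \<subseteq> G" "T \<notin> \<I> \<or> S - T \<notin> \<I>"
      using assms unfolding dep_supp_def carrier_ext_alg by blast+
    then show ?thesis using T(1) indep_mono[of S T] indep_mono[of S "S - T"] by blast
  qed
  then show "dep_supp (ext_mult h f)" "dep_supp (ext_mult f h)" by (auto simp: dep_supp_def)
qed

text \<open>The Leibniz rule read backwards: a product with a derivative of b is the derivative of a
  product minus a product with b, and multiplication preserves dependent supports.\<close>

lemma osrel_mult:
  assumes f: "f \<in> osrel" and h: "h \<in> carrier (ext_alg G)"
  shows "ext_mult h f \<in> osrel" "ext_mult f h \<in> osrel"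
proof -
  obtain a b where ab: "dep_supp a" "dep_supp b" "f = (\<lambda>S. a S + ext_der G b S)"
    using f by (rule osrel_ext_derE)
  note b = dep_supp_carrier[OF ab(2)]
  note h' = grade_inv_carrier[OF h]
  have l: "ext_mult h (ext_der G b) =
      (\<lambda>S. ext_der G (ext_mult (grade_inv h) b) S - ext_mult (ext_der G (grade_inv h)) b S)"
    using ext_der_mult[OF finite_ground h' b] by simp
  show "ext_mult h f \<in> osrel"
    unfolding ab(3) ext_mult_add_right l
    by (intro osrel_add osrel_diff osrel_ext_der osrel_dep dep_supp_mult ab h h' ext_der_carrier)
  have r: "ext_mult (ext_der G b) h =
      (\<lambda>S. ext_der G (ext_mult b h) S - ext_mult (grade_inv b) (ext_der G h) S)"
    using ext_der_mult[OF finite_ground b h] by simp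
  show "ext_mult f h \<in> osrel"
    unfolding ab(3) ext_mult_add_left r
    by (intro osrel_add osrel_diff osrel_ext_der osrel_dep dep_supp_mult dep_supp_grade_inv
        ab h ext_der_carrier)
qed

lemma ideal_osrel: "ideal (osrel :: ('a set \<Rightarrow> 'k::field) set) (ext_alg G)"
proof (rule idealI)
  interpret ring "ext_alg G :: ('a set \<Rightarrow> 'k) ring" by (rule ring_ext_alg[OF finite_ground])
  show "ring (ext_alg G :: ('a set \<Rightarrow> 'k) ring)" ..
  show "subgroup (osrel :: ('a set \<Rightarrow> 'k) set) (add_monoid (ext_alg G))"
  proof (rule add.subgroupI)
    fix f :: "'a set \<Rightarrow> 'k" assume f: "f \<in> osrel"
    then have "\<ominus>\<^bsub>ext_alg G\<^esub> f = (\<lambda>S. - 1 * f S)"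
      using ext_alg_uminus[OF finite_ground osrel_carrier[OF f]] by simp
    then show "\<ominus>\<^bsub>ext_alg G\<^esub> f \<in> osrel" using osrel_scale[OF f, of "- 1"] by simp
  qed (use osrel_carrier osrel_add osrel_zero in auto)
qed (use osrel_mult in auto)

text \<open>The relations form an ideal containing the generators. Conversely, the generated ideal
  contains the circuits themselves, then all dependent basis elements and their derivatives, then
  their linear combinations.\<close>

lemma os_ideal_eq: "os_ideal G \<I> = (osrel :: ('a set \<Rightarrow> 'k::field) set)"
proof
  interpret ring "ext_alg G :: ('a set \<Rightarrow> 'k) ring" by (rule ring_ext_alg[OF finite_ground])
  let ?gen = "(\<lambda>C. ext_der G (ext_basis C)) ` circuits G \<I> :: ('a set \<Rightarrow> 'k) set"
  have dep: "dep_supp (ext_basis C :: 'a set \<Rightarrow> 'k)" if "C \<in> circuits G \<I>" for C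
    using circuitD[OF that] by (auto simp: dep_supp_def ext_basis_def)
  have gen: "?gen \<subseteq> osrel" using osrel_ext_der dep by auto
  then show "os_ideal G \<I> \<subseteq> (osrel :: ('a set \<Rightarrow> 'k) set)"
    unfolding os_ideal_def by (rule genideal_minimal[OF ideal_osrel])
  have "?gen \<subseteq> carrier (ext_alg G)" using gen osrel_carrier by blast
  note K = genideal_ideal[OF this] genideal_self[OF this]
  define K where "K = Idl\<^bsub>ext_alg G\<^esub> ?gen"
  interpret K: ideal K "ext_alg G" unfolding K_def by (rule K)
  have K_gen: "ext_der G (ext_basis C) \<in> K" if "C \<in> circuits G \<I>" for C
    using K(2) that by (auto simp: K_def)
  have K_add: "(\<lambda>S. f S + g S) \<in> K" if "f \<in> K" "g \<in> K" for f g
    using K.a_closed[OF that] by simp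
  have K_zero: "(\<lambda>_. 0) \<in> K" using K.zero_closed by simp
  have K_mult: "ext_mult h f \<in> K" "ext_mult f h \<in> K" if "f \<in> K" "h \<in> carrier (ext_alg G)" for f h
    using K.I_l_closed[OF that] K.I_r_closed[OF that] by simp_all
  \<comment> \<open>Scalars act as multiplication by multiples of the unit.\<close>
  have K_scale: "(\<lambda>S. c * f S) \<in> K" if "f \<in> K" for f c
  proof -
    have "ext_mult (\<lambda>S. c * ext_basis {} S) f = (\<lambda>S. c * f S)"
      using K.Icarr[OF that] unfolding ext_mult_scale_left
      by (subst ext_mult_one_left) (auto simp: carrier_ext_alg intro: finite_subG)
    moreover have "(\<lambda>S. c * ext_basis {} S) \<in> carrier (ext_alg G)"
      by (auto simp: carrier_ext_alg ext_basis_def split: if_splits)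
    ultimately show ?thesis using K_mult(1)[OF that] by metis
  qed
  have K_sum: "(\<lambda>S. \<Sum>x\<in>A. f x S) \<in> K" if "\<And>x. x \<in> A \<Longrightarrow> f x \<in> K"
    for A :: "'a set set" and f :: "'a set \<Rightarrow> 'a set \<Rightarrow> 'k"
    using that by (induction A rule: infinite_finite_induct) (auto simp: K_zero intro: K_add)
  \<comment> \<open>For i in C, deriving the zero product of \<open>e_i\<close> and
    \<open>e_C\<close> gives \<open>e_C\<close> as \<open>e_i\<close> times the derivative of
    \<open>e_C\<close>.\<close>
  have circ: "ext_basis C \<in> K" if C: "C \<in> circuits G \<I>" for C
  proof -
    obtain i where i: "i \<in> C" using circuitD(4)[OF C] by auto
    then have iG: "i \<in> G" using circuitD(1)[OF C] by auto
    note carr = ext_basis_carrier[of "{i}" G, where 'b = 'k] ext_basis_carrier[of C G, where 'b = 'k]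
    have 0: "ext_mult (ext_basis {i}) (ext_basis C) = (\<lambda>_. 0 :: 'k)"
      using i circuitD(3)[OF C] by (auto simp: ext_mult_basis)
    have 1: "ext_mult (ext_der G (ext_basis {i})) (ext_basis C) = (ext_basis C :: 'a set \<Rightarrow> 'k)"
    proof -
      have "ext_der G (ext_basis {i}) = (ext_basis {} :: 'a set \<Rightarrow> 'k)"
        using ext_der_generator[OF finite_ground iG] by simp
      then show ?thesis
        using circuitD(3)[OF C] by (simp only:) (rule ext_mult_one_left, simp add: ext_basis_def split: if_splits)
    qed
    have 2: "grade_inv (ext_basis {i}) = (\<lambda>S. - 1 * ext_basis {i} S :: 'k)"
      by (auto simp: grade_inv_def ext_basis_def)
    have "(\<lambda>S. ext_basis C S + - 1 * ext_mult (ext_basis {i}) (ext_der G (ext_basis C)) S) = (\<lambda>_. 0 :: 'k)"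
      using ext_der_mult[OF finite_ground carr] iG circuitD(1)[OF C]
      unfolding 0 1 2 ext_mult_scale_left by (simp add: ext_der_def)
    then have "ext_basis C = ext_mult (ext_basis {i}) (ext_der G (ext_basis C) :: 'a set \<Rightarrow> 'k)"
      by (auto simp: fun_eq_iff)
    moreover have "ext_mult (ext_basis {i}) (ext_der G (ext_basis C)) \<in> K"
      using carr iG by (intro K_mult K_gen C) auto
    ultimately show ?thesis by simp
  qed
  \<comment> \<open>Factor a circuit out of D up to sign and apply the Leibniz rule to the
    product.\<close>
  have dependent: "ext_basis D \<in> K \<and> ext_der G (ext_basis D) \<in> K" if D: "D \<subseteq> G" "D \<notin> \<I>" for D
  proof -
    obtain C where C: "C \<in> circuits G \<I>" "C \<subseteq> D" using circuit_exists D by blast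
    define s where "s = (ext_sign (D - C) C :: 'k)"
    have "D - C \<union> C = D" using C by auto
    then have "ext_mult (ext_basis (D - C)) (ext_basis C) = (\<lambda>S. s * ext_basis D S)"
      using D C finite_subG by (simp add: ext_mult_basis s_def Int_commute)
    then have e: "ext_basis D = (\<lambda>S. s * ext_mult (ext_basis (D - C)) (ext_basis C) S)"
      by (simp add: s_def)
    have carr: "ext_basis (D - C) \<in> carrier (ext_alg G)" "ext_basis C \<in> carrier (ext_alg G)"
      using D C by (auto intro!: ext_basis_carrier)
    show ?thesis
      unfolding e ext_der_scale ext_der_mult[OF finite_ground carr]
      by (intro conjI K_scale K_add K_mult circ K_gen C carr ext_der_carrier grade_inv_carrier)
  qed
  have supp: "f \<in> K \<and> ext_der G f \<in> K" if f: "dep_supp f" for f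
  proof -
    let ?A = "{D. D \<subseteq> G \<and> D \<notin> \<I>}"
    have fin: "finite ?A" using finite_ground by simp
    have e: "f = (\<lambda>S. \<Sum>D\<in>?A. f D * ext_basis D S)"
    proof
      fix S
      have "(\<Sum>D\<in>?A. f D * ext_basis D S) = (\<Sum>D\<in>?A. if S = D then f D else 0)"
        by (intro sum.cong) (auto simp: ext_basis_def)
      then show "f S = (\<Sum>D\<in>?A. f D * ext_basis D S)"
        using f fin by (auto simp: dep_supp_def)
    qed
    have "(\<lambda>S. \<Sum>D\<in>?A. f D * ext_basis D S) \<in> K"
      using dependent by (intro K_sum K_scale) auto
    moreover have "ext_der G (\<lambda>S. \<Sum>D\<in>?A. f D * ext_basis D S) \<in> K"
      unfolding ext_der_sum ext_der_scale using dependent by (intro K_sum K_scale) auto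
    ultimately show ?thesis using e by simp
  qed
  show "(osrel :: ('a set \<Rightarrow> 'k) set) \<subseteq> os_ideal G \<I>"
  proof
    fix f :: "'a set \<Rightarrow> 'k" assume "f \<in> osrel"
    then obtain a b where "dep_supp a" "dep_supp b" "f = (\<lambda>S. a S + ext_der G b S)"
      by (rule osrel_ext_derE)
    then show "f \<in> os_ideal G \<I>" using supp K_add unfolding os_ideal_def K_def by blast
  qed
qed

section \<open>Classes in the quotient and triviality of the cohomology\<close>

lemma
  fixes f g :: "'a set \<Rightarrow> 'k::field"
  assumes f: "f \<in> carrier (ext_alg G)" and g: "g \<in> carrier (ext_alg G)"
  shows os_class_eq_iff: "os_class G \<I> f = os_class G \<I> g \<longleftrightarrow> (\<lambda>S. f S - g S) \<in> osrel"
    and os_class_mult: "os_class G \<I> f \<otimes>\<^bsub>os_alg G \<I>\<^esub> os_class G \<I> g = os_class G \<I> (ext_mult f g)"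
    and os_class_add: "os_class G \<I> f \<oplus>\<^bsub>os_alg G \<I>\<^esub> os_class G \<I> g = os_class G \<I> (\<lambda>S. f S + g S)"
    and os_class_zero: "\<zero>\<^bsub>os_alg G \<I>\<^esub> = (os_class G \<I> (\<lambda>_. 0) :: ('a set \<Rightarrow> 'k) set)"
proof -
  interpret I: ideal "osrel :: ('a set \<Rightarrow> 'k) set" "ext_alg G" by (rule ideal_osrel)
  note hom = ring_hom_mult[OF I.rcos_ring_hom] ring_hom_add[OF I.rcos_ring_hom]
  show "os_class G \<I> f = os_class G \<I> g \<longleftrightarrow> (\<lambda>S. f S - g S) \<in> osrel"
    using I.quotient_eq_iff_same_a_r_cos[OF ideal_osrel f g]
    by (simp add: os_class_def os_ideal_eq ext_alg_minus[OF finite_ground g])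
  show "os_class G \<I> f \<otimes>\<^bsub>os_alg G \<I>\<^esub> os_class G \<I> g = os_class G \<I> (ext_mult f g)"
    using hom(1)[OF f g] by (simp add: os_class_def os_alg_def os_ideal_eq)
  show "os_class G \<I> f \<oplus>\<^bsub>os_alg G \<I>\<^esub> os_class G \<I> g = os_class G \<I> (\<lambda>S. f S + g S)"
    using hom(2)[OF f g] by (simp add: os_class_def os_alg_def os_ideal_eq)
  show "\<zero>\<^bsub>os_alg G \<I>\<^esub> = (os_class G \<I> (\<lambda>_. 0) :: ('a set \<Rightarrow> 'k) set)"
    using I.a_rcos_zero[OF ideal_osrel osrel_zero]
    by (simp add: os_class_def os_alg_def os_ideal_eq FactRing_def)
qed

lemma ext_deg_carrier: "f \<in> ext_deg G p \<Longrightarrow> f \<in> carrier (ext_alg G)"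
  by (auto simp: ext_deg_def carrier_ext_alg)

lemma ext_vec_carrier: "ext_vec G v \<in> carrier (ext_alg G)"
  unfolding carrier_ext_alg
proof (intro allI impI)
  fix S assume "ext_vec G v S \<noteq> 0"
  then obtain i where "i \<in> G" "ext_basis {i} S \<noteq> (0 :: 'b)"
    unfolding ext_vec_def by (metis (no_types, lifting) mult_zero_right sum.neutral)
  then show "S \<subseteq> G" by (auto simp: ext_basis_def split: if_splits)
qed

text \<open>Translates exactness for representatives in the exterior algebra into triviality of the
  factor group.\<close>

lemma not_resonant:
  fixes v :: "'a \<Rightarrow> 'k::field"
  assumes exact: "\<And>x. x \<in> ext_deg G p \<Longrightarrow> ext_mult x (ext_vec G v) \<in> osrel \<Longrightarrow>
    \<exists>y. (\<forall>S. y S \<noteq> 0 \<longrightarrow> S \<subseteq> G \<and> Suc (card S) = p) \<and>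
      (\<lambda>S. x S - ext_mult y (ext_vec G v) S) \<in> osrel"
  shows "v \<notin> resonance G \<I> p"
proof -
  let ?V = "ext_vec G v"
  \<comment> \<open>Representatives of the coboundaries. The shape with \<open>Suc\<close> treats
    all degrees at once: for p = 0 only y = 0 qualifies, so W consists of zero.\<close>
  define W where "W = {ext_mult y ?V | y. \<forall>S. y S \<noteq> 0 \<longrightarrow> S \<subseteq> G \<and> Suc (card S) = p}"
  define H where "H = os_class G \<I> ` W"
  have mult0: "ext_mult (\<lambda>_. 0) ?V = (\<lambda>_. 0)" by (simp add: ext_mult_def)
  have diff: "os_diff G \<I> v (os_class G \<I> y) = os_class G \<I> (ext_mult y ?V)"
    if "y \<in> carrier (ext_alg G)" for y
    unfolding os_diff_def by (rule os_class_mult[OF that ext_vec_carrier])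
  have W_carrier: "w \<in> carrier (ext_alg G)" if w: "w \<in> W" for w
  proof -
    obtain y where y: "w = ext_mult y ?V" "\<forall>S. y S \<noteq> 0 \<longrightarrow> S \<subseteq> G \<and> Suc (card S) = p"
      using w by (auto simp: W_def)
    have "y \<in> carrier (ext_alg G)" using y(2) by (simp add: carrier_ext_alg)
    then show ?thesis unfolding y(1) by (intro ext_mult_carrier ext_vec_carrier)
  qed
  have coboundaries: "os_coboundaries G \<I> v p = H"
  proof (cases p)
    case 0
    then have "W = {\<lambda>_. 0}" using mult0 by (auto simp: W_def fun_eq_iff[symmetric] intro!: exI[of _ "\<lambda>_. 0"])
    then show ?thesis
      using 0 os_class_zero[of "\<lambda>_. 0 :: 'k" "\<lambda>_. 0"]
      by (simp add: os_coboundaries_def H_def carrier_ext_alg)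
  next
    case (Suc q)
    then have "W = (\<lambda>y. ext_mult y ?V) ` ext_deg G q" by (auto simp: W_def ext_deg_def)
    then show ?thesis
      using Suc diff by (auto simp: os_coboundaries_def H_def os_deg_def image_image ext_deg_carrier)
  qed
  have W_diff: "(\<lambda>S. f S - g S) \<in> W" if f: "f \<in> W" and g: "g \<in> W" for f g
  proof -
    obtain y z where y: "f = ext_mult y ?V" "\<forall>S. y S \<noteq> 0 \<longrightarrow> S \<subseteq> G \<and> Suc (card S) = p"
      and z: "g = ext_mult z ?V" "\<forall>S. z S \<noteq> 0 \<longrightarrow> S \<subseteq> G \<and> Suc (card S) = p"
      using f g by (auto simp: W_def)
    have "(\<lambda>S. f S - g S) = ext_mult (\<lambda>S. y S - z S) ?V"
      by (simp add: y z ext_mult_def right_diff_distrib left_diff_distrib sum_subtractf)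
    moreover have "\<forall>S. y S - z S \<noteq> 0 \<longrightarrow> S \<subseteq> G \<and> Suc (card S) = p"
      using y(2) z(2) by (metis diff_self)
    ultimately show ?thesis unfolding W_def by blast
  qed
  have W_zero: "(\<lambda>_. 0) \<in> W"
    unfolding W_def using mult0 by (intro CollectI exI[of _ "\<lambda>_. 0"]) simp
  have W_add: "(\<lambda>S. f S + g S) \<in> W" if "f \<in> W" "g \<in> W" for f g
    using W_diff[OF that(1) W_diff[OF W_zero that(2)]] by simp
  have cocycles: "os_cocycles G \<I> v p \<subseteq> H"
  proof
    fix X assume "X \<in> os_cocycles G \<I> v p"
    then obtain x where x: "x \<in> ext_deg G p" "X = os_class G \<I> x"
      "os_diff G \<I> v X = \<zero>\<^bsub>os_alg G \<I>\<^esub>"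
      by (auto simp: os_cocycles_def os_deg_def)
    note xc = ext_deg_carrier[OF x(1)]
    have zc: "(\<lambda>_. 0) \<in> carrier (ext_alg G)" by (simp add: carrier_ext_alg)
    have "os_class G \<I> (ext_mult x ?V) = os_class G \<I> (\<lambda>_. 0)"
      using x(3) diff[OF xc] os_class_zero[OF zc zc] by (simp add: x(2))
    then have "ext_mult x ?V \<in> osrel"
      using os_class_eq_iff[OF ext_mult_carrier[OF xc ext_vec_carrier] zc] by simp
    from exact[OF x(1) this] obtain y where y: "\<forall>S. y S \<noteq> 0 \<longrightarrow> S \<subseteq> G \<and> Suc (card S) = p"
      "(\<lambda>S. x S - ext_mult y ?V S) \<in> osrel" by blast
    then have w: "ext_mult y ?V \<in> W" by (auto simp: W_def)
    have "X = os_class G \<I> (ext_mult y ?V)"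
      unfolding x(2) os_class_eq_iff[OF xc W_carrier[OF w]] by (rule y(2))
    then show "X \<in> H" using w by (auto simp: H_def)
  qed
  have coset: "(\<Union>h\<in>H. {h \<oplus>\<^bsub>os_alg G \<I>\<^esub> a}) = H" if "a \<in> H" for a
  proof -
    obtain w where w: "w \<in> W" "a = os_class G \<I> w" using \<open>a \<in> H\<close> by (auto simp: H_def)
    have add: "os_class G \<I> u \<oplus>\<^bsub>os_alg G \<I>\<^esub> a = os_class G \<I> (\<lambda>S. u S + w S)" if "u \<in> W" for u
      unfolding w(2) by (rule os_class_add[OF W_carrier[OF that] W_carrier[OF w(1)]])
    have "os_class G \<I> u \<in> (\<Union>h\<in>H. {h \<oplus>\<^bsub>os_alg G \<I>\<^esub> a})" if u: "u \<in> W" for u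
    proof -
      have "os_class G \<I> (\<lambda>S. u S - w S) \<oplus>\<^bsub>os_alg G \<I>\<^esub> a = os_class G \<I> u"
        unfolding add[OF W_diff[OF u w(1)]] by simp
      moreover have "os_class G \<I> (\<lambda>S. u S - w S) \<in> H" using W_diff[OF u w(1)] by (auto simp: H_def)
      ultimately show ?thesis by force
    qed
    moreover have "os_class G \<I> u \<oplus>\<^bsub>os_alg G \<I>\<^esub> a \<in> H" if "u \<in> W" for u
      unfolding add[OF that] using W_add[OF that w(1)] by (auto simp: H_def)
    ultimately show ?thesis by (auto simp: H_def)
  qed
  \<comment> \<open>A cocycle exists, so the set of cosets is {H} and not empty.\<close>
  have "os_class G \<I> (\<lambda>_. 0) \<in> os_cocycles G \<I> v p"
  proof -
    have zc: "(\<lambda>_. 0) \<in> carrier (ext_alg G)" by (simp add: carrier_ext_alg)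
    show ?thesis
      using diff[OF zc] os_class_zero[OF zc zc] mult0
      by (auto simp: os_cocycles_def os_deg_def ext_deg_def intro!: image_eqI[of _ _ "\<lambda>_. 0"])
  qed
  then have "os_cocycles G \<I> v p \<noteq> {}" by auto
  then have "(\<lambda>a. \<Union>h\<in>H. {h \<oplus>\<^bsub>os_alg G \<I>\<^esub> a}) ` os_cocycles G \<I> v p = {H}"
    using cocycles coset by (auto simp: subset_iff image_iff)
  moreover have "carrier (os_cohomology G \<I> v p) =
      (\<lambda>a. \<Union>h\<in>H. {h \<oplus>\<^bsub>os_alg G \<I>\<^esub> a}) ` os_cocycles G \<I> v p"
    by (auto simp: os_cohomology_def FactGroup_def RCOSETS_def r_coset_def coboundaries)
  ultimately have "carrier (os_cohomology G \<I> v p) = {H}" by simp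
  then show ?thesis
    by (simp add: resonance_def os_cohomology_def FactGroup_def coboundaries)
qed

section \<open>The inclusion for an arbitrary nonempty finite ordered ground set\<close>

text \<open>A resonant v has a cocycle x that is no coboundary. A loop, a nonzero total sum, or the
  absence of a suitable flat would each make x a coboundary. Nonemptiness of G supplies the
  generator for the contraction.\<close>

theorem resonance_subset:
  assumes "G \<noteq> {}"
  shows "(resonance G \<I> p :: ('a \<Rightarrow> 'k::field) set) \<subseteq> (\<Union>X\<in>irr_flats_le G \<I> (p + 1). P_space G X)"
proof
  fix v :: "'a \<Rightarrow> 'k"
  assume v: "v \<in> resonance G \<I> p"
  obtain g where g: "g \<in> G" using assms by auto
  \<comment> \<open>Elements of the function space are \<open>undefined\<close> outside G; w is zero
    there, so that multiplication by it preserves supports in G.\<close>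
  define w where "w i = (if i \<in> G then v i else 0)" for i
  have mult: "ext_mult x (ext_vec G v) = rmul w x" for x
    unfolding w_def using finite_ground by (rule ext_mult_vec)
  have wG: "i \<in> G" if "w i \<noteq> 0" for i using that by (auto simp: w_def split: if_splits)
  have sum_w: "(\<Sum>i\<in>X. w i) = (\<Sum>i\<in>X. v i)" if "X \<subseteq> G" for X
    using that by (intro sum.cong) (auto simp: w_def)
  obtain x where x: "x \<in> ext_deg G p" "rmul w x \<in> osrel"
    and nonexact: "\<And>y. (\<And>S. y S \<noteq> 0 \<Longrightarrow> S \<subseteq> G \<and> Suc (card S) = p) \<Longrightarrow>
      (\<lambda>S. x S - rmul w y S) \<notin> osrel"
    using not_resonant[of p v] v unfolding mult by blast
  have fin: "finite S" if "x S \<noteq> 0" for S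
    using that x(1) finite_subG by (auto simp: ext_deg_def)
  \<comment> \<open>A loop puts the unit into the ideal; the algebra is then zero and x is bounded
    by 0.\<close>
  have noloop: "{y} \<in> \<I>" if y: "y \<in> G" for y
  proof (rule ccontr)
    assume "{y} \<notin> \<I>"
    then have "dep_supp (ext_basis {y} :: 'a set \<Rightarrow> 'k)"
      using y by (auto simp: dep_supp_def ext_basis_def)
    then have "ext_basis {} \<in> (osrel :: ('a set \<Rightarrow> 'k) set)"
      using osrel_ext_der ext_der_generator[OF finite_ground y, where 'k = 'k] by force
    then have "ext_mult x (ext_basis {}) \<in> osrel"
      by (rule osrel_mult) (rule ext_deg_carrier[OF x(1)])
    then have "x \<in> osrel" by (simp add: ext_mult_one_right fin)
    then show False using nonexact[of "\<lambda>_. 0"] by (simp add: rmul_def)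
  qed
  have total: "(\<Sum>i\<in>G. v i) = 0"
  proof (rule ccontr)
    define c where "c = (\<Sum>i\<in>G. v i)"
    assume "(\<Sum>i\<in>G. v i) \<noteq> 0"
    then have c: "c \<noteq> 0" by (simp add: c_def)
    \<comment> \<open>The primitive given by the homotopy: the Clifford relation for G expresses c
      times x as the derivative of a relation plus a coboundary.\<close>
    define y where "y S = inverse c * rder G x S" for S
    have y: "S \<subseteq> G \<and> Suc (card S) = p" if nz: "y S \<noteq> 0" for S
    proof -
      have "rder G x S \<noteq> 0" using nz by (simp add: y_def)
      then obtain i where "i \<in> G - S" "x (insert i S) \<noteq> 0" by (rule rder_nonzeroE)
      then show ?thesis using x(1) finite_subG[of S] by (force simp: ext_deg_def)
    qed
    have "(\<lambda>S. c * x S) = (\<lambda>S. rder G (rmul w x) S + rmul w (rder G x) S)"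
      using rder_rmul_fun[OF finite_ground fin, where v = w] by (simp add: sum_w c_def)
    then have "c * x S - rmul w (rder G x) S = rder G (rmul w x) S" for S
      by (metis add_diff_cancel_right')
    moreover have "rmul w y = (\<lambda>S. inverse c * rmul w (rder G x) S)"
      unfolding y_def by (rule rmul_scale)
    then have "x S - rmul w y S = inverse c * (c * x S - rmul w (rder G x) S)" for S
      using c by (simp add: right_diff_distrib flip: mult.assoc)
    ultimately have "(\<lambda>S. x S - rmul w y S) = (\<lambda>S. inverse c * rder G (rmul w x) S)" by simp
    also have "\<dots> \<in> osrel" by (intro osrel_scale osrel_rder_ground x)
    finally show False using nonexact y by blast
  qed
  have "\<exists>X\<in>irr_flats_le G \<I> (p + 1). (\<Sum>i\<in>X. v i) = 0"
  proof (rule ccontr)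
    assume none: "\<not> ?thesis"
    have nonres: "(\<Sum>i\<in>X. w i) \<noteq> 0" if "X \<in> irr_flats_le G \<I> (p + 1)" for X
    proof -
      have "X \<subseteq> G" using that by (auto simp: irr_flats_le_def flats_def)
      then show ?thesis using none that by (simp add: sum_w)
    qed
    obtain y where "\<And>S. y S \<noteq> 0 \<Longrightarrow> S \<subseteq> G \<and> Suc (card S) = p" "(\<lambda>S. x S - rmul w y S) \<in> osrel"
      using exact_nonresonant[OF noloop g nonres wG x] by blast
    then show False using nonexact by blast
  qed
  then obtain X where X: "X \<in> irr_flats_le G \<I> (p + 1)" "(\<Sum>i\<in>X. v i) = 0" by blast
  then have XG: "X \<subseteq> G" by (auto simp: irr_flats_le_def flats_def)
  have "(\<Sum>i\<in>G - X. v i) = 0"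
    using sum.subset_diff[OF XG finite_ground, of v] total X(2) by simp
  moreover have "v \<in> G \<rightarrow>\<^sub>E UNIV" using v by (simp add: resonance_def)
  ultimately show "v \<in> (\<Union>X\<in>irr_flats_le G \<I> (p + 1). P_space G X)"
    using X by (auto simp: P_space_def)
qed

end

theorem theorem3p12:
  fixes n l p :: nat and \<I> :: "nat set set"
  assumes "1 \<le> n"
    and "matroid {1..n} \<I>"
    and "mrank \<I> {1..n} = l"
    and "p \<le> l"
  shows "(resonance {1..n} \<I> p :: (nat \<Rightarrow> 'k::field) set)
         \<subseteq> (\<Union>X\<in>irr_flats_le {1..n} \<I> (p + 1). P_space {1..n} X)"
proof -
  interpret ordered_matroid "{1..n}" \<I>
    using assms(2) by (simp add: ordered_matroid_def)
  show ?thesis using assms(1) by (intro resonance_subset) simp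
qed

end
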